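(* Let $a,b$ be fixed real numbers with $0<a<1<b$. The following are equivalent: (i) the Kadison-Singer conjecture is true, i.e. for every $\omega\in\beta\mathbb N$ the state $s_\omega$ on $\mathcal D$ extends uniquely to a state on $B(\ell^2(\mathbb N))$; (ii) for each $H=H^*\in B(\ell^2(\mathbb N))$ with $E(H)=0$ and each $\epsilon>0$, there exist an $r$ and an $r$-paving $\{A_1,\dots,A_r\}$ of $\mathbb N$ with $-\epsilon P_{A_i}\le P_{A_i}HP_{A_i}\le \epsilon P_{A_i}$ for $i=1,\dots,r$; (iii) for each $\epsilon>0$ there exists an $r$ such that for every $H=H^*\in B(\ell^2(\mathbb N))$ with $E(H)=0$ there exists an $r$-paving $\{A_1,\dots,A_r\}$ of $\mathbb N$ with $\|P_{A_i}HP_{A_i}\|\le\epsilon\|H\|$ for $i=1,\dots,r$; (iv) for each positive invertible $P\in B(\ell^2(\mathbb N))$ and each $\epsilon>0$, there exist an $r$, an $r$-paving $\{A_1,\dots,A_r\}$ of $\mathbb N$ and positive real numbers $c_1,\dots,c_r,d_1,\dots,d_r$ with $c_id_i>1-\epsilon$ such that $c_iP_{A_i}\le P_{A_i}PP_{A_i}$ and $d_iP_{A_i}\le P_{A_i}P^{-1}P_{A_i}$ for $i=1,\dots,r$; (v) for each $P\in\mathcal P[a,b]$ and each $\epsilon>0$, there exist an $r$, an $r$-paving $\{A_1,\dots,A_r\}$ of $\mathbb N$ and positive real numbers $c_1,\dots,c_r,d_1,\dots,d_r$ with $c_id_i>1-\epsilon$ such that $c_iP_{A_i}\le P_{A_i}PP_{A_i}$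 and $d_iP_{A_i}\le P_{A_i}P^{-1}P_{A_i}$ for $i=1,\dots,r$; (vi) for each $\epsilon>0$ there exists an $r$ such that for every $P\in\mathcal P[a,b]$ there are an $r$-paving $\{A_1,\dots,A_r\}$ of $\mathbb N$ and positive real numbers $c_1,\dots,c_r,d_1,\dots,d_r$ with $c_id_i>1-\epsilon$ such that $c_iP_{A_i}\le P_{A_i}PP_{A_i}$ and $d_iP_{A_i}\le P_{A_i}P^{-1}P_{A_i}$ for $i=1,\dots,r$.
   Context: Operators $X\in B(\ell^2(\mathbb N))$ (complex Hilbert space) are identified with their infinite matrices $X=(x_{i,j})$ with respect to the canonical orthonormal basis. $\mathcal D\subseteq B(\ell^2(\mathbb N))$ is the algebra (MASA) of diagonal operators, and $E:B(\ell^2(\mathbb N))\to\mathcal D$ is the conditional expectation $E((x_{i,j}))=(d_{i,j})$ with $d_{i,i}=x_{i,i}$ and $d_{i,j}=0$ for $i\ne j$. $\mathcal D$ is identified with the continuous functions on the Stone-Čech compactification $\beta\mathbb N$ (a bounded diagonal sequence is identified with its continuous extension to $\beta\mathbb N$), and for $\omega\in\beta\mathbb N$, $s_\omega:\mathcal D\to\mathbb C$ is the *-homomorphism given by evaluation at $\omega$; these are exactly the pure states of $\mathcal D$. For $A\subseteq\mathbb N$, $P_A$ is the diagonal projection whose $(i,i)$ entry is $1$ if and only if $i\in A$. An $r$-paving of $\mathbb N$ is a finite collection of disjoint subsets $\{A_1,\dots,A_r\}$ with $\mathbb N=A_1\cup\dots\cup A_r$. $\mathcal P[a,b]$ denotes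 the set of positive $P\in B(\ell^2(\mathbb N))$ with $aI\le P\le bI$. *)

theory Defs
  imports "HOL-Analysis.Analysis" "HOL-Library.Complex_Order"
begin

section \<open>The complex Hilbert space of square-summable sequences\<close>

class complex_vector = real_vector +
  fixes scaleC :: "complex \<Rightarrow> 'a \<Rightarrow> 'a"  (infixr "*\<^sub>C" 75)
  assumes scaleC_add_right: "c *\<^sub>C (x + y) = c *\<^sub>C x + c *\<^sub>C y"
    and scaleC_add_left: "(c + d) *\<^sub>C x = c *\<^sub>C x + d *\<^sub>C x"
    and scaleC_scaleC: "c *\<^sub>C d *\<^sub>C x = (c * d) *\<^sub>C x"
    and scaleR_scaleC: "r *\<^sub>R x = complex_of_real r *\<^sub>C x"

typedef ell2 = "{x :: nat \<Rightarrow> complex. summable (\<lambda>n. (cmod (x n))\<^sup>2)}"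
  morphisms coord Abs_ell2
  by (rule exI[of _ "\<lambda>_. 0"]) simp

setup_lifting type_definition_ell2

lemma ell2_eqI: "(\<And>n. coord x n = coord y n) \<Longrightarrow> x = y"
  by (metis coord_inject ext)

lemma coord_summable: "summable (\<lambda>n. (cmod (coord x n))\<^sup>2)"
  using coord[of x] by simp

lemma summable_sq_add:
  assumes "summable (\<lambda>n. (cmod (x n))\<^sup>2)" "summable (\<lambda>n. (cmod (y n))\<^sup>2)"
  shows "summable (\<lambda>n. (cmod (x n + y n))\<^sup>2)"
proof (rule summable_comparison_test')
  show "summable (\<lambda>n. 2 * (cmod (x n))\<^sup>2 + 2 * (cmod (y n))\<^sup>2)"
    using assms by (intro summable_add summable_mult)
  fix n :: nat
  have "(cmod (x n + y n))\<^sup>2 \<le> (cmod (x n) + cmod (y n))\<^sup>2"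
    by (intro power_mono norm_triangle_ineq) auto
  also have "\<dots> \<le> 2 * (cmod (x n))\<^sup>2 + 2 * (cmod (y n))\<^sup>2"
    using zero_le_power2[of "cmod (x n) - cmod (y n)"] by (simp add: power2_eq_square algebra_simps)
  finally show "norm ((cmod (x n + y n))\<^sup>2) \<le> 2 * (cmod (x n))\<^sup>2 + 2 * (cmod (y n))\<^sup>2"
    by simp
qed

lemma summable_sq_mult:
  assumes "summable (\<lambda>n. (cmod (x n))\<^sup>2)" and "\<And>n. cmod (d n) \<le> B"
  shows "summable (\<lambda>n. (cmod (d n * x n))\<^sup>2)"
proof (rule summable_comparison_test')
  show "summable (\<lambda>n. B\<^sup>2 * (cmod (x n))\<^sup>2)" using assms(1) by (rule summable_mult)
  show "norm ((cmod (d n * x n))\<^sup>2) \<le> B\<^sup>2 * (cmod (x n))\<^sup>2" for n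
    using assms(2)[of n] by (auto simp: norm_mult power_mult_distrib intro!: mult_right_mono power_mono)
qed

instantiation ell2 :: complex_vector
begin

lift_definition zero_ell2 :: ell2 is "\<lambda>_. 0" by simp
lift_definition plus_ell2 :: "ell2 \<Rightarrow> ell2 \<Rightarrow> ell2" is "\<lambda>x y n. x n + y n"
  by (rule summable_sq_add)
lift_definition uminus_ell2 :: "ell2 \<Rightarrow> ell2" is "\<lambda>x n. - x n" by simp
lift_definition minus_ell2 :: "ell2 \<Rightarrow> ell2 \<Rightarrow> ell2" is "\<lambda>x y n. x n - y n"
  using summable_sq_add[where y = "\<lambda>n. - y n" for y] by simp
lift_definition scaleC_ell2 :: "complex \<Rightarrow> ell2 \<Rightarrow> ell2" is "\<lambda>c x n. c * x n"
  by (rule summable_sq_mult) auto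
definition scaleR_ell2 :: "real \<Rightarrow> ell2 \<Rightarrow> ell2" where
  "scaleR_ell2 r x = complex_of_real r *\<^sub>C x"

instance
  by standard
    (rule ell2_eqI, simp add: zero_ell2.rep_eq plus_ell2.rep_eq uminus_ell2.rep_eq
      minus_ell2.rep_eq scaleC_ell2.rep_eq scaleR_ell2_def algebra_simps)+

end

lemma coord_simps [simp]:
  "coord 0 n = 0" "coord (x + y) n = coord x n + coord y n"
  "coord (- x) n = - coord x n" "coord (x - y) n = coord x n - coord y n"
  "coord (c *\<^sub>C x) n = c * coord x n" "coord (r *\<^sub>R x) n = complex_of_real r * coord x n"
  by (simp_all add: zero_ell2.rep_eq plus_ell2.rep_eq uminus_ell2.rep_eq minus_ell2.rep_eq
      scaleC_ell2.rep_eq scaleR_ell2_def)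

definition cinner :: "ell2 \<Rightarrow> ell2 \<Rightarrow> complex" where
  "cinner x y = (\<Sum>n. coord x n * cnj (coord y n))"

lemma cinner_abs_summable: "summable (\<lambda>n. norm (coord x n * cnj (coord y n)))"
proof (rule summable_comparison_test')
  show "summable (\<lambda>n. (cmod (coord x n))\<^sup>2 + (cmod (coord y n))\<^sup>2)"
    by (intro summable_add coord_summable)
  fix n :: nat
  have "2 * (cmod (coord x n) * cmod (coord y n)) \<le> (cmod (coord x n))\<^sup>2 + (cmod (coord y n))\<^sup>2"
    using zero_le_power2[of "cmod (coord x n) - cmod (coord y n)"]
    by (simp add: power2_eq_square algebra_simps)
  moreover have "0 \<le> cmod (coord x n) * cmod (coord y n)" by simp
  ultimately have "cmod (coord x n) * cmod (coord y n)
      \<le> (cmod (coord x n))\<^sup>2 + (cmod (coord y n))\<^sup>2" by linarith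
  then show "norm (norm (coord x n * cnj (coord y n)))
      \<le> (cmod (coord x n))\<^sup>2 + (cmod (coord y n))\<^sup>2"
    by (simp add: norm_mult)
qed

lemma cinner_summable: "summable (\<lambda>n. coord x n * cnj (coord y n))"
  using cinner_abs_summable by (rule summable_norm_cancel)

lemma cinner_commute: "cinner y x = cnj (cinner x y)"
proof -
  have "(\<lambda>n. cnj (coord x n * cnj (coord y n))) sums cnj (cinner x y)"
    unfolding cinner_def sums_cnj by (rule summable_sums[OF cinner_summable])
  then show ?thesis by (simp add: cinner_def sums_iff mult.commute)
qed

lemma cinner_add_left: "cinner (x + y) z = cinner x z + cinner y z"
  unfolding cinner_def by (simp add: suminf_add[OF cinner_summable cinner_summable] algebra_simps)

lemma cinner_scaleC_left: "cinner (c *\<^sub>C x) y = c * cinner x y"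
  unfolding cinner_def by (simp add: suminf_mult[OF cinner_summable, symmetric] algebra_simps)

lemma cinner_self: "cinner x x = complex_of_real (\<Sum>n. (cmod (coord x n))\<^sup>2)"
  unfolding cinner_def
  by (simp add: complex_norm_square[symmetric] suminf_of_real[OF coord_summable] del: of_real_power)

instantiation ell2 :: real_inner
begin

definition inner_ell2 :: "ell2 \<Rightarrow> ell2 \<Rightarrow> real" where
  "inner_ell2 x y = Re (cinner x y)"
definition norm_ell2 :: "ell2 \<Rightarrow> real" where
  "norm_ell2 x = sqrt (\<Sum>n. (cmod (coord x n))\<^sup>2)"
definition sgn_ell2 :: "ell2 \<Rightarrow> ell2" where
  "sgn_ell2 x = x /\<^sub>R norm x"
definition dist_ell2 :: "ell2 \<Rightarrow> ell2 \<Rightarrow> real" where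
  "dist_ell2 x y = norm (x - y)"
definition uniformity_ell2 :: "(ell2 \<times> ell2) filter" where
  "uniformity_ell2 = (INF e\<in>{0<..}. principal {(x, y). dist x y < e})"
definition open_ell2 :: "ell2 set \<Rightarrow> bool" where
  "open_ell2 U = (\<forall>x\<in>U. \<forall>\<^sub>F (x', y) in uniformity. x' = x \<longrightarrow> y \<in> U)"

instance
proof
  fix x y z :: ell2 and r :: real
  show "inner x y = inner y x"
    unfolding inner_ell2_def by (metis cinner_commute complex_cnj(1) complex.sel(1) complex_surj)
  show "inner (x + y) z = inner x z + inner y z"
    by (simp add: inner_ell2_def cinner_add_left)
  show "inner (r *\<^sub>R x) y = r * inner x y"
    by (simp add: inner_ell2_def scaleR_scaleC cinner_scaleC_left)
  show "0 \<le> inner x x"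
    by (simp add: inner_ell2_def cinner_self suminf_nonneg coord_summable)
  show "inner x x = 0 \<longleftrightarrow> x = 0"
    using suminf_eq_zero_iff[OF coord_summable, of x]
    by (auto simp: inner_ell2_def cinner_self intro: ell2_eqI)
  show "norm x = sqrt (inner x x)"
    by (simp add: inner_ell2_def cinner_self norm_ell2_def)
qed (auto simp: sgn_ell2_def dist_ell2_def uniformity_ell2_def open_ell2_def)

end

lemma cinner_self_norm: "cinner x x = complex_of_real ((norm x)\<^sup>2)"
  by (simp add: cinner_self norm_ell2_def suminf_nonneg coord_summable del: of_real_power)

lemma norm_sq_ell2: "(norm x)\<^sup>2 = (\<Sum>n. (cmod (coord x n))\<^sup>2)"
  by (simp add: norm_ell2_def suminf_nonneg coord_summable)

lemma norm_scaleC_ell2: "norm (c *\<^sub>C x) = cmod c * norm (x :: ell2)"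
  by (simp add: norm_ell2_def norm_mult power_mult_distrib suminf_mult[OF coord_summable]
      real_sqrt_mult)

lift_definition basis_vec :: "nat \<Rightarrow> ell2" is "\<lambda>k n. if n = k then 1 else 0"
  by (rule summable_finite[of "{k}" for k]) auto

lemma coord_basis_vec: "coord (basis_vec k) n = (if n = k then 1 else 0)"
  by transfer simp

lifting_forget ell2.lifting

section \<open>Bounded operators\<close>

typedef bop = "{T :: ell2 \<Rightarrow>\<^sub>L ell2. \<forall>c x. blinfun_apply T (c *\<^sub>C x) = c *\<^sub>C blinfun_apply T x}"
  morphisms blinfun_of_bop Abs_bop
  by (rule exI[of _ 0]) (simp add: ell2_eqI)

setup_lifting type_definition_bop

lift_definition app :: "bop \<Rightarrow> ell2 \<Rightarrow> ell2" is blinfun_apply .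

lemma bop_eqI: "(\<And>x. app S x = app T x) \<Longrightarrow> S = T"
  by transfer (rule blinfun_eqI)

lemma app_scaleC: "app T (c *\<^sub>C x) = c *\<^sub>C app T x"
  by transfer simp

instantiation bop :: real_vector
begin

lift_definition zero_bop :: bop is 0 by (simp add: ell2_eqI)
lift_definition plus_bop :: "bop \<Rightarrow> bop \<Rightarrow> bop" is "(+)"
  by (simp add: blinfun.add_left scaleC_add_right)
lift_definition uminus_bop :: "bop \<Rightarrow> bop" is uminus
  by (simp add: blinfun.minus_left ell2_eqI)
lift_definition minus_bop :: "bop \<Rightarrow> bop \<Rightarrow> bop" is "(-)"
  by (simp add: blinfun.diff_left ell2_eqI algebra_simps)
lift_definition scaleR_bop :: "real \<Rightarrow> bop \<Rightarrow> bop" is "(*\<^sub>R)"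
  by (simp add: blinfun.scaleR_left ell2_eqI)

instance
proof
  fix S T R :: bop and r s :: real
  show "S + T + R = S + (T + R)" "S + T = T + S" "0 + S = S" "- S + S = 0" "S - T = S + - T"
    by (transfer; simp)+
  show "r *\<^sub>R (S + T) = r *\<^sub>R S + r *\<^sub>R T" "(r + s) *\<^sub>R S = r *\<^sub>R S + s *\<^sub>R S"
    "r *\<^sub>R s *\<^sub>R S = (r * s) *\<^sub>R S" "1 *\<^sub>R S = S"
    by (transfer; simp add: algebra_simps)+
qed

end

instantiation bop :: real_normed_vector
begin

lift_definition norm_bop :: "bop \<Rightarrow> real" is norm .
definition sgn_bop :: "bop \<Rightarrow> bop" where
  "sgn_bop T = T /\<^sub>R norm T"
definition dist_bop :: "bop \<Rightarrow> bop \<Rightarrow> real" where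
  "dist_bop S T = norm (S - T)"
definition uniformity_bop :: "(bop \<times> bop) filter" where
  "uniformity_bop = (INF e\<in>{0<..}. principal {(S, T). dist S T < e})"
definition open_bop :: "bop set \<Rightarrow> bool" where
  "open_bop U = (\<forall>S\<in>U. \<forall>\<^sub>F (S', T) in uniformity. S' = S \<longrightarrow> T \<in> U)"

instance
proof
  fix S T :: bop and r :: real
  show "norm S = 0 \<longleftrightarrow> S = 0" "norm (S + T) \<le> norm S + norm T" "norm (r *\<^sub>R S) = \<bar>r\<bar> * norm S"
    by (transfer; simp add: norm_triangle_ineq)+
qed (auto simp: sgn_bop_def dist_bop_def uniformity_bop_def open_bop_def)

end

text \<open>Multiplication is composition and \<open>1\<close> is the identity operator.\<close>

instantiation bop :: real_normed_algebra_1
begin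

lift_definition one_bop :: bop is id_blinfun by simp
lift_definition times_bop :: "bop \<Rightarrow> bop \<Rightarrow> bop" is "(o\<^sub>L)" by simp

instance
proof
  fix S T R :: bop and r :: real
  show "S * T * R = S * (T * R)" "1 * S = S" "S * 1 = S"
    by (transfer; rule blinfun_eqI; simp)+
  show "(S + T) * R = S * R + T * R" "S * (T + R) = S * T + S * R"
    "(r *\<^sub>R S) * T = r *\<^sub>R (S * T)" "S * (r *\<^sub>R T) = r *\<^sub>R (S * T)"
    by (transfer; rule blinfun_eqI; simp add: blinfun.bilinear_simps)+
  show "norm (S * T) \<le> norm S * norm T" by transfer (rule norm_blinfun_compose)
  have "coord (basis_vec 0) 0 = 1" by (simp add: coord_basis_vec)
  then have ne: "basis_vec 0 \<noteq> 0" by auto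
  have le: "norm (id_blinfun :: ell2 \<Rightarrow>\<^sub>L ell2) \<le> 1"
    by (rule norm_blinfun_bound) auto
  have "norm (basis_vec 0) \<le> norm (id_blinfun :: ell2 \<Rightarrow>\<^sub>L ell2) * norm (basis_vec 0)"
    using norm_blinfun[of "id_blinfun :: ell2 \<Rightarrow>\<^sub>L ell2" "basis_vec 0"] by simp
  with ne le have "norm (id_blinfun :: ell2 \<Rightarrow>\<^sub>L ell2) = 1" by simp
  then show "norm (1 :: bop) = 1" by transfer
  then show "(0 :: bop) \<noteq> 1" by (metis norm_zero zero_neq_one)
qed

end

lift_definition scaleC_blinfun :: "complex \<Rightarrow> (ell2 \<Rightarrow>\<^sub>L ell2) \<Rightarrow> ell2 \<Rightarrow>\<^sub>L ell2" is
  "\<lambda>c T x. c *\<^sub>C T x"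
proof -
  fix c and T :: "ell2 \<Rightarrow> ell2"
  assume "bounded_linear T"
  then interpret T: bounded_linear T .
  obtain K where K: "\<And>x. norm (T x) \<le> norm x * K" using T.bounded by blast
  show "bounded_linear (\<lambda>x. c *\<^sub>C T x)"
  proof (rule bounded_linear_intro)
    fix x y :: ell2 and r :: real
    show "c *\<^sub>C T (x + y) = c *\<^sub>C T x + c *\<^sub>C T y"
      by (simp add: T.add scaleC_add_right)
    show "c *\<^sub>C T (r *\<^sub>R x) = r *\<^sub>R c *\<^sub>C T x"
      by (simp add: T.scaleR ell2_eqI)
    show "norm (c *\<^sub>C T x) \<le> norm x * (cmod c * K)"
      using mult_left_mono[OF K[of x], of "cmod c"] by (simp add: norm_scaleC_ell2 mult_ac)
  qed
qed

instantiation bop :: complex_vector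
begin

lift_definition scaleC_bop :: "complex \<Rightarrow> bop \<Rightarrow> bop" is scaleC_blinfun
  by (simp add: scaleC_blinfun.rep_eq scaleC_scaleC mult.commute)

lemma app_bop_scaleC: "app (c *\<^sub>C T) x = c *\<^sub>C app T x"
  by (simp add: app.rep_eq scaleC_bop.rep_eq scaleC_blinfun.rep_eq)

instance
proof
  fix S T :: bop and c d :: complex and r :: real
  have add: "app (S + T) x = app S x + app T x" for S T x
    by transfer (simp add: blinfun.add_left)
  have sc: "app (r *\<^sub>R T) x = r *\<^sub>R app T x" for T x
    by transfer (simp add: blinfun.scaleR_left)
  show "c *\<^sub>C (S + T) = c *\<^sub>C S + c *\<^sub>C T" "(c + d) *\<^sub>C S = c *\<^sub>C S + d *\<^sub>C S"
    "c *\<^sub>C d *\<^sub>C S = (c * d) *\<^sub>C S" "r *\<^sub>R S = complex_of_real r *\<^sub>C S"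
    by (rule bop_eqI, simp add: add sc app_bop_scaleC scaleC_add_right scaleC_add_left
        scaleC_scaleC scaleR_scaleC)+
qed

end

lemma app_simps [simp]:
  "app 0 x = 0" "app (S + T) x = app S x + app T x" "app (- T) x = - app T x"
  "app (S - T) x = app S x - app T x" "app (r *\<^sub>R T) x = r *\<^sub>R app T x"
  "app (c *\<^sub>C T) x = c *\<^sub>C app T x" "app 1 x = x" "app (S * T) x = app S (app T x)"
  by (transfer; simp add: blinfun.bilinear_simps; fail | rule app_bop_scaleC)+

lemma bounded_linear_app: "bounded_linear (app T)"
  by transfer (rule blinfun.bounded_linear_right)

lemma app_norm_le: "norm (app T x) \<le> norm T * norm x"
  by transfer (rule norm_blinfun)

text \<open>The order on complex numbers is that of \<open>Complex_Order\<close>: \<open>0 \<le> z\<close> says that \<open>z\<close> is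
  real and nonnegative.\<close>

definition positive_op :: "bop \<Rightarrow> bool" where
  "positive_op T \<longleftrightarrow> (\<forall>x. 0 \<le> cinner (app T x) x)"

lemma cinner_add_right: "cinner x (y + z) = cinner x y + cinner x z"
  by (metis cinner_commute cinner_add_left complex_cnj_add)

lemma cinner_scaleC_right: "cinner x (c *\<^sub>C y) = cnj c * cinner x y"
  by (metis cinner_commute cinner_scaleC_left complex_cnj_mult)

lemma cinner_zero [simp]: "cinner 0 x = 0" "cinner x 0 = 0"
  by (simp_all add: cinner_def)

lemma cinner_minus_left: "cinner (- x) y = - cinner x y"
  using cinner_add_left[of x "- x" y] by (simp add: add_eq_0_iff)

lemma bop_quadratic_zero:
  assumes "\<And>x. cinner (app T x) x = 0"
  shows "T = 0"
proof (rule bop_eqI)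
  fix x
  define y where "y = app T x"
  have add: "app T (u + v) = app T u + app T v" for u v
    by (rule bounded_linear_app[THEN bounded_linear.linear, THEN linear_add])
  have p: "cinner (app T x) (c *\<^sub>C y) + cinner (app T (c *\<^sub>C y)) x = 0" for c
    using assms[of "x + c *\<^sub>C y"] assms[of x] assms[of "c *\<^sub>C y"]
    by (simp add: add cinner_add_left cinner_add_right add.commute)
  have "cinner y y + cinner (app T y) x = 0"
    using p[of 1] by (simp add: app_scaleC cinner_scaleC_left cinner_scaleC_right y_def)
  moreover have "- \<i> * cinner y y + \<i> * cinner (app T y) x = 0"
    using p[of \<i>] by (simp add: app_scaleC cinner_scaleC_left cinner_scaleC_right y_def)
  then have "\<i> * (- cinner y y + cinner (app T y) x) = 0"
    by (simp add: algebra_simps)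
  then have "- cinner y y + cinner (app T y) x = 0" by simp
  ultimately have "cinner y y = 0"
    by algebra
  then show "app T x = app 0 x" by (simp add: y_def cinner_self_norm)
qed


instantiation bop :: ordered_real_vector
begin

definition less_eq_bop :: "bop \<Rightarrow> bop \<Rightarrow> bool" where
  "S \<le> T \<longleftrightarrow> positive_op (T - S)"
definition less_bop :: "bop \<Rightarrow> bop \<Rightarrow> bool" where
  "(S :: bop) < T \<longleftrightarrow> S \<le> T \<and> \<not> T \<le> S"

instance
proof
  fix S T R :: bop and r s :: real
  have add: "positive_op (A + B)" if "positive_op A" "positive_op B" for A B
    using that by (simp add: positive_op_def cinner_add_left)
  have scale: "positive_op (t *\<^sub>R A)" if "positive_op A" "0 \<le> t" for A t
    using that by (simp add: positive_op_def scaleR_scaleC cinner_scaleC_left less_eq_complex_def)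
  show "S < T \<longleftrightarrow> S \<le> T \<and> \<not> T \<le> S" by (rule less_bop_def)
  show "S \<le> S" by (simp add: less_eq_bop_def positive_op_def)
  show "S \<le> R" if "S \<le> T" "T \<le> R"
    using add[of "T - S" "R - T"] that by (simp add: less_eq_bop_def)
  show "S = T" if "S \<le> T" "T \<le> S"
  proof -
    have "cinner (app (T - S) x) x = 0" for x
    proof -
      have "0 \<le> cinner (app (T - S) x) x" "0 \<le> cinner (app (S - T) x) x"
        using that by (simp_all only: less_eq_bop_def positive_op_def)
      moreover have "app (S - T) x = - app (T - S) x" by simp
      ultimately show ?thesis
        by (metis antisym cinner_minus_left neg_0_le_iff_le)
    qed
    then show ?thesis using bop_quadratic_zero[of "T - S"] by simp
  qed
  show "R + S \<le> R + T" if "S \<le> T"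
    using that by (simp add: less_eq_bop_def)
  show "r *\<^sub>R S \<le> r *\<^sub>R T" if "S \<le> T" "0 \<le> r"
    using scale[of "T - S" r] that by (simp add: less_eq_bop_def scaleR_diff_right)
  show "r *\<^sub>R S \<le> s *\<^sub>R S" if "r \<le> s" "0 \<le> S"
    using scale[of S "s - r"] that by (simp add: less_eq_bop_def scaleR_diff_left)
qed

end

lemma positive_op_iff: "positive_op T \<longleftrightarrow> 0 \<le> T"
  by (simp add: less_eq_bop_def)

subsection \<open>Adjoint\<close>

definition adj :: "bop \<Rightarrow> bop" where
  "adj T = (THE S. \<forall>x y. cinner (app S x) y = cinner x (app T y))"

lemma cinner_minus_right: "cinner x (- y) = - cinner x y"
  using cinner_add_right[of x y "- y"] by (simp add: add_eq_0_iff)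

lemma cinner_diff_left: "cinner (x - y) z = cinner x z - cinner y z"
  using cinner_add_left[of x "- y" z] by (simp add: cinner_minus_left)

lemma cinner_diff_right: "cinner x (y - z) = cinner x y - cinner x z"
  using cinner_add_right[of x y "- z"] by (simp add: cinner_minus_right)

lemma cinner_sum_right: "cinner x (sum f A) = (\<Sum>i\<in>A. cinner x (f i))"
  by (induction A rule: infinite_finite_induct) (simp_all add: cinner_add_right)

lemma coord_sum: "coord (sum f A) n = (\<Sum>i\<in>A. coord (f i) n)"
  by (induction A rule: infinite_finite_induct) simp_all

lemma cmod_cinner_le: "cmod (cinner x y) \<le> norm x * norm y"
proof (cases "cinner x y = 0")
  case False
  define c where "c = cnj (cinner x y) / cmod (cinner x y)"
  have c: "cmod c = 1" using False by (simp add: c_def norm_divide)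
  have "c * cinner x y = complex_of_real (cmod (cinner x y) ^ 2) / cmod (cinner x y)"
    by (simp add: c_def complex_norm_square mult.commute del: of_real_power)
  then have "c * cinner x y = complex_of_real (cmod (cinner x y))"
    using False by (simp add: power2_eq_square)
  then have "cmod (cinner x y) = inner (c *\<^sub>C x) y"
    by (simp add: inner_ell2_def cinner_scaleC_left)
  also have "\<dots> \<le> norm (c *\<^sub>C x) * norm y" by (rule norm_cauchy_schwarz)
  finally show ?thesis by (simp add: norm_scaleC_ell2 c)
qed simp

definition trunc :: "nat \<Rightarrow> (nat \<Rightarrow> complex) \<Rightarrow> ell2" where
  "trunc N a = (\<Sum>j<N. a j *\<^sub>C basis_vec j)"

lemma coord_trunc: "coord (trunc N a) n = (if n < N then a n else 0)"
  by (simp add: trunc_def coord_sum coord_basis_vec if_distrib[of "\<lambda>x. _ * x"] sum.delta cong: if_cong)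

lemma norm_trunc_sq: "(norm (trunc N a))\<^sup>2 = (\<Sum>j<N. (cmod (a j))\<^sup>2)"
proof -
  have "(\<Sum>n. (cmod (coord (trunc N a) n))\<^sup>2) = (\<Sum>j<N. (cmod (coord (trunc N a) j))\<^sup>2)"
    by (rule suminf_finite) (auto simp: coord_trunc)
  then show ?thesis by (simp add: norm_sq_ell2 coord_trunc)
qed

lemma trunc_tendsto: "(\<lambda>N. trunc N (coord x)) \<longlonglongrightarrow> x"
proof -
  let ?s = "\<lambda>n. (cmod (coord x n))\<^sup>2"
  have eq: "(norm (trunc N (coord x) - x))\<^sup>2 = suminf ?s - (\<Sum>j<N. ?s j)" for N
  proof -
    have "(\<lambda>n. if n \<in> {..<N} then ?s n else 0) sums (\<Sum>j<N. ?s j)"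
      by (rule sums_If_finite_set) simp
    from sums_diff[OF summable_sums[OF coord_summable[of x]] this]
    have "(\<lambda>n. (cmod (coord (trunc N (coord x) - x) n))\<^sup>2) sums (suminf ?s - (\<Sum>j<N. ?s j))"
      by (rule back_subst[of "\<lambda>f. f sums _"]) (auto simp: coord_trunc fun_eq_iff)
    then show ?thesis by (simp add: norm_sq_ell2 sums_iff)
  qed
  have "(\<lambda>N. suminf ?s - (\<Sum>j<N. ?s j)) \<longlonglongrightarrow> suminf ?s - suminf ?s"
    by (intro tendsto_intros summable_LIMSEQ coord_summable)
  then have "(\<lambda>N. (norm (trunc N (coord x) - x))\<^sup>2) \<longlonglongrightarrow> 0" by (simp add: eq)
  from tendsto_real_sqrt[OF this] have "(\<lambda>N. norm (trunc N (coord x) - x)) \<longlonglongrightarrow> 0" by simp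
  then show ?thesis by (simp add: LIM_zero_iff tendsto_norm_zero_iff)
qed

lemma app_trunc: "app T (trunc N a) = (\<Sum>j<N. a j *\<^sub>C app T (basis_vec j))"
  unfolding trunc_def
  by (subst linear_sum[OF bounded_linear.linear[OF bounded_linear_app]]) (simp add: app_scaleC)

lemma ell2_ext_cinner: "(\<And>y. cinner u y = cinner v y) \<Longrightarrow> u = v"
  by (metis cinner_diff_left cinner_self_norm eq_iff_diff_eq_0 norm_eq_zero of_real_eq_0_iff
      power_eq_0_iff)

lemma adj_ex1: "\<exists>!S. \<forall>x y. cinner (app S x) y = cinner x (app T y)"
proof -
  have "\<exists>z. \<forall>x. cinner z x = cinner y (app T x)" for y
  proof -
    define c where "c j = cinner y (app T (basis_vec j))" for j
    have inner_trunc: "cinner y (app T (trunc N a)) = (\<Sum>j<N. c j * cnj (a j))" for N a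
      by (simp add: app_trunc cinner_sum_right cinner_scaleC_right c_def mult.commute)
    have "(\<Sum>j<N. (cmod (c j))\<^sup>2) \<le> (norm y * norm T)\<^sup>2" for N
    proof -
      let ?u = "trunc N c"
      have "complex_of_real ((norm ?u)\<^sup>2) = cinner y (app T ?u)"
        by (simp add: inner_trunc norm_trunc_sq complex_norm_square del: of_real_power)
      then have "(norm ?u)\<^sup>2 = cmod (cinner y (app T ?u))"
        by (metis abs_of_nonneg norm_of_real zero_le_power2)
      also have "\<dots> \<le> norm y * norm (app T ?u)" by (rule cmod_cinner_le)
      also have "\<dots> \<le> norm y * (norm T * norm ?u)" by (intro mult_left_mono app_norm_le) auto
      finally have "norm ?u * norm ?u \<le> (norm y * norm T) * norm ?u"
        by (simp add: power2_eq_square mult.assoc)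
      then have "norm ?u \<le> norm y * norm T"
        by (cases "norm ?u = 0") auto
      then have "(norm ?u)\<^sup>2 \<le> (norm y * norm T)\<^sup>2" by (intro power_mono) auto
      then show ?thesis by (simp add: norm_trunc_sq)
    qed
    then have "summable (\<lambda>j. (cmod (c j))\<^sup>2)"
      by (intro summableI_nonneg_bounded) auto
    then have z: "coord (Abs_ell2 c) = c" by (simp add: Abs_ell2_inverse)
    have "cinner (Abs_ell2 c) x = cinner y (app T x)" for x
    proof (rule LIMSEQ_unique)
      show "(\<lambda>N. cinner y (app T (trunc N (coord x)))) \<longlonglongrightarrow> cinner (Abs_ell2 c) x"
        using summable_LIMSEQ[OF cinner_summable[of "Abs_ell2 c" x]]
        by (simp add: inner_trunc z cinner_def[of "Abs_ell2 c"])
      have "bounded_linear (\<lambda>v. cinner y v)"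
        by (rule bounded_linear_intro[where K = "norm y"])
          (auto simp: cinner_add_right scaleR_scaleC cinner_scaleC_right scaleR_conv_of_real
            cmod_cinner_le mult.commute[of "norm _" "norm y"])
      from bounded_linear.tendsto[OF bounded_linear_compose[OF this bounded_linear_app] trunc_tendsto]
      show "(\<lambda>N. cinner y (app T (trunc N (coord x)))) \<longlonglongrightarrow> cinner y (app T x)" .
    qed
    then show ?thesis by blast
  qed
  then obtain f where f: "\<And>y x. cinner (f y) x = cinner y (app T x)" by metis
  have f_scaleC: "f (c *\<^sub>C y) = c *\<^sub>C f y" for c y
    by (rule ell2_ext_cinner) (simp add: f cinner_scaleC_left)
  have bl: "bounded_linear f"
  proof (rule bounded_linear_intro)
    fix x y :: ell2 and r :: real
    show "f (x + y) = f x + f y" by (rule ell2_ext_cinner) (simp add: f cinner_add_left)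
    show "f (r *\<^sub>R x) = r *\<^sub>R f x" by (simp add: scaleR_scaleC f_scaleC)
    have "(norm (f x))\<^sup>2 = cmod (cinner x (app T (f x)))"
      by (metis f cinner_self_norm abs_of_nonneg norm_of_real zero_le_power2)
    also have "\<dots> \<le> norm x * norm (app T (f x))" by (rule cmod_cinner_le)
    also have "\<dots> \<le> norm x * (norm T * norm (f x))" by (intro mult_left_mono app_norm_le) auto
    finally have "norm (f x) * norm (f x) \<le> (norm x * norm T) * norm (f x)"
      by (simp add: power2_eq_square mult.assoc)
    then show "norm (f x) \<le> norm x * norm T" by (cases "norm (f x) = 0") auto
  qed
  have app_f: "app (Abs_bop (Blinfun f)) x = f x" for x
    by (simp add: app.rep_eq Abs_bop_inverse bounded_linear_Blinfun_apply[OF bl] f_scaleC)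
  then have "\<forall>x y. cinner (app (Abs_bop (Blinfun f)) x) y = cinner x (app T y)"
    by (simp add: f)
  then show ?thesis
  proof (rule ex1I)
    fix S assume S: "\<forall>x y. cinner (app S x) y = cinner x (app T y)"
    show "S = Abs_bop (Blinfun f)"
    proof (rule bop_eqI)
      show "app S x = app (Abs_bop (Blinfun f)) x" for x
        by (rule ell2_ext_cinner) (simp add: S app_f f)
    qed
  qed
qed

lemma cinner_adj: "cinner (app (adj T) x) y = cinner x (app T y)"
  using theI'[OF adj_ex1[of T]] unfolding adj_def by blast

subsection \<open>Inverse\<close>

definition op_invertible :: "bop \<Rightarrow> bool" where
  "op_invertible T \<longleftrightarrow> (\<exists>S. S * T = 1 \<and> T * S = 1)"

definition op_inverse :: "bop \<Rightarrow> bop" where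
  "op_inverse T = (THE S. S * T = 1 \<and> T * S = 1)"

lemma op_inverse:
  assumes "op_invertible T"
  shows "op_inverse T * T = 1" "T * op_inverse T = 1"
proof -
  have "\<exists>!S. S * T = 1 \<and> T * S = 1"
    using assms unfolding op_invertible_def by (metis mult.assoc mult_1_left mult_1_right)
  from theI'[OF this] show "op_inverse T * T = 1" "T * op_inverse T = 1"
    by (simp_all add: op_inverse_def)
qed

section \<open>Diagonal operators\<close>

definition entry :: "bop \<Rightarrow> nat \<Rightarrow> nat \<Rightarrow> complex" where
  "entry X i j = coord (app X (basis_vec j)) i"

text \<open>Only meaningful for bounded \<open>d\<close>.\<close>

definition diag :: "(nat \<Rightarrow> complex) \<Rightarrow> bop" where
  "diag d = (THE D. \<forall>x n. coord (app D x) n = d n * coord x n)"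

lemma coord_diag:
  assumes "bounded (range d)"
  shows "coord (app (diag d) x) n = d n * coord x n"
proof -
  obtain B where B: "\<And>n. cmod (d n) \<le> B"
    using assms by (auto simp: bounded_iff)
  then have B0: "0 \<le> B" using norm_ge_zero order_trans by blast
  define f where "f x = Abs_ell2 (\<lambda>n. d n * coord x n)" for x
  have f: "coord (f x) n = d n * coord x n" for x n
    using summable_sq_mult[OF coord_summable[of x] B] by (simp add: f_def Abs_ell2_inverse)
  have bl: "bounded_linear f"
  proof (rule bounded_linear_intro)
    fix x y :: ell2 and r :: real
    show "f (x + y) = f x + f y" "f (r *\<^sub>R x) = r *\<^sub>R f x"
      by (rule ell2_eqI, simp add: f algebra_simps)+
    have "(\<Sum>n. (cmod (coord (f x) n))\<^sup>2) \<le> (\<Sum>n. B\<^sup>2 * (cmod (coord x n))\<^sup>2)"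
      using B by (intro suminf_le coord_summable summable_mult)
        (auto simp: f norm_mult power_mult_distrib intro!: mult_right_mono power_mono)
    then have "(norm (f x))\<^sup>2 \<le> (norm x * B)\<^sup>2"
      by (simp add: norm_sq_ell2 suminf_mult[OF coord_summable] power_mult_distrib mult.commute)
    then show "norm (f x) \<le> norm x * B" by (rule power2_le_imp_le) (simp add: B0)
  qed
  have "app (Abs_bop (Blinfun f)) x = f x" for x
    by (subst app.rep_eq, subst Abs_bop_inverse)
      (auto simp: bounded_linear_Blinfun_apply[OF bl] f intro: ell2_eqI)
  then have "\<exists>!D. \<forall>x n. coord (app D x) n = d n * coord x n"
    by (intro ex1I[of _ "Abs_bop (Blinfun f)"]) (auto simp: f intro!: bop_eqI ell2_eqI)
  from theI'[OF this] show ?thesis by (simp add: diag_def)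
qed

definition diagonals :: "bop set" where
  "diagonals = {D. \<forall>i j. i \<noteq> j \<longrightarrow> entry D i j = 0}"

lemma bounded_entries: "bounded (range (\<lambda>n. entry X n n))"
proof -
  have "cmod (coord x n) \<le> norm x" for x n
  proof -
    have "coord x n = cinner x (basis_vec n)"
      unfolding cinner_def using suminf_finite[of "{n}" "\<lambda>k. coord x k * cnj (coord (basis_vec n) k)"]
      by (simp add: coord_basis_vec)
    moreover have "norm (basis_vec n) = 1"
      unfolding norm_ell2_def using suminf_finite[of "{n}" "\<lambda>k. (cmod (coord (basis_vec n) k))\<^sup>2"]
      by (simp add: coord_basis_vec)
    ultimately show ?thesis using cmod_cinner_le[of x "basis_vec n"] by simp
  qed
  moreover have "norm (basis_vec n) = 1" for n
    unfolding norm_ell2_def using suminf_finite[of "{n}" "\<lambda>k. (cmod (coord (basis_vec n) k))\<^sup>2"]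
    by (simp add: coord_basis_vec)
  ultimately have "cmod (entry X n n) \<le> norm X" for n
    unfolding entry_def using app_norm_le[of X "basis_vec n"] by (metis mult.right_neutral order_trans)
  then show ?thesis by (auto simp: bounded_iff)
qed

definition cond_exp :: "bop \<Rightarrow> bop" where
  "cond_exp X = diag (\<lambda>i. entry X i i)"

definition diag_proj :: "nat set \<Rightarrow> bop" where
  "diag_proj A = diag (\<lambda>i. if i \<in> A then 1 else 0)"

definition paving :: "nat \<Rightarrow> (nat \<Rightarrow> nat set) \<Rightarrow> bool" where
  "paving r A \<longleftrightarrow> disjoint_family_on A {1..r} \<and> (\<Union>i\<in>{1..r}. A i) = UNIV"

definition op_interval :: "real \<Rightarrow> real \<Rightarrow> bop set" where
  "op_interval a b = {P. positive_op P \<and> a *\<^sub>R 1 \<le> P \<and> P \<le> b *\<^sub>R 1}"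

section \<open>The Stone-Cech compactification of the natural numbers\<close>

text \<open>The points are the ultrafilters on the natural numbers, and \<open>n\<close> is identified with the
  principal ultrafilter \<open>principal {n}\<close>.\<close>

definition ultrafilter :: "'a filter \<Rightarrow> bool" where
  "ultrafilter F \<longleftrightarrow> F \<noteq> bot \<and> (\<forall>P. eventually P F \<or> eventually (\<lambda>x. \<not> P x) F)"

definition beta_nat :: "nat filter topology" where
  "beta_nat = topology_generated_by (range (\<lambda>A. {F. ultrafilter F \<and> (\<forall>\<^sub>F n in F. n \<in> A)}))"

lemma topspace_beta_nat: "topspace beta_nat = Collect ultrafilter"
  unfolding beta_nat_def topology_generated_by_topspace
  by (auto intro!: exI[of _ UNIV])

lemma openin_beta_nat_basic: "openin beta_nat {F. ultrafilter F \<and> (\<forall>\<^sub>F n in F. n \<in> A)}"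
  unfolding beta_nat_def by (rule topology_generated_by_Basis) auto

lemma ultrafilter_not:
  assumes "ultrafilter F"
  shows "eventually (\<lambda>x. \<not> P x) F \<longleftrightarrow> \<not> eventually P F"
proof -
  have "\<not> (eventually P F \<and> eventually (\<lambda>x. \<not> P x) F)"
    using assms by (simp add: ultrafilter_def flip: eventually_conj_iff)
  then show ?thesis using assms by (auto simp: ultrafilter_def)
qed

lemma ultrafilter_principal: "ultrafilter (principal {n})"
  by (auto simp: ultrafilter_def eventually_principal principal_eq_bot_iff)

lemma Hausdorff_beta_nat: "Hausdorff_space beta_nat"
  unfolding Hausdorff_space_def topspace_beta_nat
proof (intro allI impI, elim conjE)
  fix F G :: "nat filter"
  assume F: "F \<in> Collect ultrafilter" and G: "G \<in> Collect ultrafilter" and "F \<noteq> G"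
  then obtain P where P: "eventually P F \<noteq> eventually P G" by (auto simp: filter_eq_iff)
  obtain Q where Q: "eventually Q F" "\<not> eventually Q G"
    using P F G ultrafilter_not[of F P] ultrafilter_not[of G P] by (cases "eventually P F") auto
  let ?U = "\<lambda>A. {F. ultrafilter F \<and> (\<forall>\<^sub>F n in F. n \<in> A)}"
  have "F \<in> ?U (Collect Q)" "G \<in> ?U (- Collect Q)" "disjnt (?U (Collect Q)) (?U (- Collect Q))"
    using F G Q by (auto simp: ultrafilter_not disjnt_def)
  then show "\<exists>U V. openin beta_nat U \<and> openin beta_nat V \<and> F \<in> U \<and> G \<in> V \<and> disjnt U V"
    using openin_beta_nat_basic by blast
qed

lemma openin_beta_nat_nbhd:
  assumes "openin beta_nat W" "F \<in> W"
  obtains A where "\<forall>\<^sub>F n in F. n \<in> A" "{G. ultrafilter G \<and> (\<forall>\<^sub>F n in G. n \<in> A)} \<subseteq> W"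
proof -
  let ?U = "\<lambda>A. {F :: nat filter. ultrafilter F \<and> (\<forall>\<^sub>F n in F. n \<in> A)}"
  have "generate_topology_on (range ?U) W"
    using assms(1) by (simp add: beta_nat_def openin_topology_generated_by_iff)
  then have "\<forall>F\<in>W. \<exists>A. F \<in> ?U A \<and> ?U A \<subseteq> W"
  proof induction
    case (Int a b)
    show ?case
    proof
      fix F assume "F \<in> a \<inter> b"
      then obtain A B where "F \<in> ?U A" "?U A \<subseteq> a" "F \<in> ?U B" "?U B \<subseteq> b" using Int.IH by blast
      then have "F \<in> ?U (A \<inter> B) \<and> ?U (A \<inter> B) \<subseteq> a \<inter> b" by (auto simp: eventually_conj_iff)
      then show "\<exists>C. F \<in> ?U C \<and> ?U C \<subseteq> a \<inter> b" by blast
    qed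
  next
    case (UN K)
    show ?case
    proof
      fix F assume "F \<in> \<Union>K"
      then obtain k where k: "k \<in> K" "F \<in> k" by blast
      then obtain A where "F \<in> ?U A" "?U A \<subseteq> k" using UN.IH by blast
      moreover from this have "?U A \<subseteq> \<Union>K" using k(1) by (meson Union_upper order_trans)
      ultimately show "\<exists>A. F \<in> ?U A \<and> ?U A \<subseteq> \<Union>K" by (intro exI[of _ A] conjI)
    qed
  next
    case (Basis W)
    then show ?case by blast
  qed simp
  then obtain A where "F \<in> ?U A" "?U A \<subseteq> W" using assms(2) by blast
  then show thesis by (intro that[of A]) simp_all
qed

lemma dense_beta_nat: "beta_nat closure_of (range (\<lambda>n. principal {n})) = topspace beta_nat"
proof (intro equalityI subsetI)
  fix F assume F: "F \<in> topspace beta_nat"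
  show "F \<in> beta_nat closure_of (range (\<lambda>n. principal {n}))"
    unfolding in_closure_of
  proof (intro conjI allI impI F, elim conjE)
    fix W assume "F \<in> W" "openin beta_nat W"
    then obtain A where A: "\<forall>\<^sub>F n in F. n \<in> A" "{G. ultrafilter G \<and> (\<forall>\<^sub>F n in G. n \<in> A)} \<subseteq> W"
      using openin_beta_nat_nbhd by blast
    have "F \<noteq> bot" using F by (simp add: topspace_beta_nat ultrafilter_def)
    then obtain n where "n \<in> A" using A(1) eventually_happens by blast
    then have "principal {n} \<in> W"
      using A(2) by (auto simp: ultrafilter_principal eventually_principal)
    then show "\<exists>G. G \<in> range (\<lambda>n. principal {n}) \<and> G \<in> W" by blast
  qed
qed (simp add: in_closure_of)

lemma ultrafilter_exists:
  assumes "F \<noteq> bot"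
  shows "\<exists>U. ultrafilter U \<and> U \<le> F"
proof -
  define ev where "ev G = {P. eventually P G}" for G :: "'a filter"
  define \<A> where "\<A> = ev ` {G. G \<noteq> bot \<and> G \<le> F}"
  have ev_le: "ev G \<subseteq> ev H \<longleftrightarrow> H \<le> G" for G H by (auto simp: ev_def le_filter_def)
  have "\<exists>M\<in>\<A>. \<forall>X\<in>\<A>. M \<subseteq> X \<longrightarrow> X = M"
  proof (rule subset_Zorn_nonempty)
    show "\<A> \<noteq> {}" using assms by (auto simp: \<A>_def)
    fix \<C> assume "\<C> \<noteq> {}" and ch: "subset.chain \<A> \<C>"
    define B where "B = {G. G \<noteq> bot \<and> G \<le> F \<and> ev G \<in> \<C>}"
    have CB: "\<C> = ev ` B"
      using ch by (auto simp: B_def \<A>_def subset.chain_def)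
    have "B \<noteq> {}" using CB \<open>\<C> \<noteq> {}\<close> by auto
    have base: "\<exists>x\<in>B. x \<le> inf G H" if "G \<in> B" "H \<in> B" for G H
    proof -
      have "ev G \<subseteq> ev H \<or> ev H \<subseteq> ev G" using ch CB that by (auto simp: subset.chain_def)
      then show ?thesis using that by (auto simp: ev_le)
    qed
    have evI: "eventually P (Inf B) \<longleftrightarrow> (\<exists>G\<in>B. eventually P G)" for P
      by (rule eventually_Inf_base[OF \<open>B \<noteq> {}\<close> base])
    have "\<Union>\<C> = ev (Inf B)" by (auto simp: CB ev_def evI)
    moreover have "Inf B \<noteq> bot"
      unfolding trivial_limit_def evI by (auto simp: B_def trivial_limit_def)
    moreover have "Inf B \<le> F"
      using \<open>B \<noteq> {}\<close> by (auto simp: B_def intro: Inf_lower2)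
    ultimately show "\<Union>\<C> \<in> \<A>" by (auto simp: \<A>_def)
  qed
  then obtain U where U: "U \<noteq> bot" "U \<le> F"
    and eq: "\<And>G. G \<noteq> bot \<Longrightarrow> G \<le> F \<Longrightarrow> G \<le> U \<Longrightarrow> ev G = ev U"
    by (auto simp: \<A>_def ev_le)
  have max: "U \<le> G" if "G \<noteq> bot" "G \<le> U" for G
    using eq[OF that(1) order_trans[OF that(2) U(2)] that(2)] ev_le[of G U] by simp
  have "eventually P U \<or> eventually (\<lambda>x. \<not> P x) U" for P
  proof (cases "inf U (principal (Collect P)) = bot")
    case True
    then show ?thesis by (auto simp: trivial_limit_def eventually_inf_principal)
  next
    case False
    then have "U \<le> inf U (principal (Collect P))" by (intro max) auto
    then have "eventually P U" by (simp add: le_principal)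
    then show ?thesis ..
  qed
  then show ?thesis using U by (auto simp: ultrafilter_def)
qed

lemma compact_beta_nat: "compact_space beta_nat"
  unfolding compact_space_alt
proof (intro allI impI, elim conjE)
  fix \<U> assume op: "\<forall>U\<in>\<U>. openin beta_nat U" and cov: "topspace beta_nat \<subseteq> \<Union>\<U>"
  let ?U = "\<lambda>A. {F :: nat filter. ultrafilter F \<and> (\<forall>\<^sub>F n in F. n \<in> A)}"
  define S where "S = {A. \<exists>W\<in>\<U>. ?U A \<subseteq> W}"
  let ?F = "INF A\<in>S. principal (- A)"
  have "?F = bot"
  proof (rule ccontr)
    assume "?F \<noteq> bot"
    then obtain G where G: "ultrafilter G" "G \<le> ?F" using ultrafilter_exists by blast
    then obtain W where "W \<in> \<U>" "G \<in> W" using cov by (auto simp: topspace_beta_nat)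
    then obtain A where A: "\<forall>\<^sub>F n in G. n \<in> A" "?U A \<subseteq> W"
      using op openin_beta_nat_nbhd by metis
    then have "A \<in> S" using \<open>W \<in> \<U>\<close> by (auto simp: S_def)
    then have "G \<le> principal (- A)" using G(2) by (meson INF_lower order_trans)
    then have "\<forall>\<^sub>F n in G. n \<notin> A" by (simp add: le_principal)
    then show False using A(1) ultrafilter_not[OF G(1)] by blast
  qed
  then have "\<exists>X\<subseteq>S. finite X \<and> (INF A\<in>X. principal (- A)) = bot"
    unfolding trivial_limit_def eventually_INF[of _ _ S] by blast
  then obtain X where X: "X \<subseteq> S" "finite X" "(INF A\<in>X. principal (- A)) = bot" by blast
  then have "(\<Inter>A\<in>X. - A) = {}"
    by (simp add: INF_principal_finite principal_eq_bot_iff)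
  then have cX: "\<Union>X = UNIV" by auto
  have "\<forall>A\<in>X. \<exists>W. W \<in> \<U> \<and> ?U A \<subseteq> W"
    using X(1) unfolding S_def by blast
  from bchoice[OF this] obtain w where w: "\<And>A. A \<in> X \<Longrightarrow> w A \<in> \<U> \<and> ?U A \<subseteq> w A"
    by metis
  have "topspace beta_nat \<subseteq> \<Union>(w ` X)"
  proof
    fix G assume "G \<in> topspace beta_nat"
    then have G: "ultrafilter G" by (simp add: topspace_beta_nat)
    have "\<exists>A\<in>X. \<forall>\<^sub>F n in G. n \<in> A"
    proof (rule ccontr)
      assume "\<not> ?thesis"
      then have "\<forall>\<^sub>F n in G. \<forall>A\<in>X. n \<notin> A"
        using ultrafilter_not[OF G] X(2) by (subst eventually_ball_finite_distrib) blast+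
      moreover have "\<not> (\<forall>A\<in>X. n \<notin> A)" for n using cX by blast
      ultimately have "\<forall>\<^sub>F n in G. False" by simp
      then show False using G by (simp add: ultrafilter_def)
    qed
    then obtain A where "A \<in> X" "G \<in> ?U A" using G by blast
    then show "G \<in> \<Union>(w ` X)" using w[of A] by blast
  qed
  moreover have "finite (w ` X)" "w ` X \<subseteq> \<U>" using X(2) w by auto
  ultimately show "\<exists>\<F>. finite \<F> \<and> \<F> \<subseteq> \<U> \<and> topspace beta_nat \<subseteq> \<Union>\<F>"
    by (intro exI[of _ "w ` X"] conjI)
qed

text \<open>The continuous extension to \<open>beta_nat\<close> of a bounded sequence \<open>f\<close>, evaluated at \<open>\<omega>\<close>.\<close>

definition beta_ext :: "(nat \<Rightarrow> complex) \<Rightarrow> nat filter \<Rightarrow> complex" where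
  "beta_ext f \<omega> =
    (THE z. \<exists>g. continuous_map beta_nat euclidean g \<and> (\<forall>n. g (principal {n}) = f n) \<and> g \<omega> = z)"

lemma beta_ext_unique:
  assumes "continuous_map beta_nat euclidean g" "continuous_map beta_nat euclidean h"
    and "\<And>n. g (principal {n}) = (h (principal {n}) :: complex)" "\<omega> \<in> topspace beta_nat"
  shows "g \<omega> = h \<omega>"
proof (rule forall_in_closure_of_eq[OF _ _ assms(1,2)])
  show "\<omega> \<in> beta_nat closure_of (range (\<lambda>n. principal {n}))"
    using assms(4) by (simp only: dense_beta_nat)
qed (use assms(3) in \<open>auto simp: Hausdorff_space_euclidean\<close>)

lemma beta_ext_exists:
  fixes f :: "nat \<Rightarrow> complex"
  assumes "bounded (range f)"
  obtains g where "continuous_map beta_nat euclidean g" "\<And>n. g (principal {n}) = f n"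
    "\<And>\<omega>. \<omega> \<in> topspace beta_nat \<Longrightarrow> (f \<longlongrightarrow> g \<omega>) \<omega>"
proof -
  have "\<exists>z. (f \<longlongrightarrow> z) \<omega>" if \<omega>: "ultrafilter \<omega>" for \<omega>
  proof -
    let ?K = "closure (range f)"
    have "compact ?K" using assms by (simp add: compact_closure)
    moreover have "filtermap f \<omega> \<noteq> bot" using \<omega> by (simp add: ultrafilter_def filtermap_bot_iff)
    moreover have "\<forall>\<^sub>F z in filtermap f \<omega>. z \<in> ?K"
      using closure_subset[of "range f"] by (auto simp: eventually_filtermap intro!: always_eventually)
    ultimately obtain z where z: "inf (nhds z) (filtermap f \<omega>) \<noteq> bot"
      unfolding compact_filter by blast
    have "\<forall>\<^sub>F n in \<omega>. f n \<in> S" if S: "open S" "z \<in> S" for S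
    proof (rule ccontr)
      assume "\<not> ?thesis"
      then have "\<forall>\<^sub>F y in filtermap f \<omega>. y \<notin> S"
        using ultrafilter_not[OF \<omega>] by (simp add: eventually_filtermap)
      moreover have "\<forall>\<^sub>F y in nhds z. y \<in> S" using S by (simp add: eventually_nhds_in_open)
      ultimately have "\<forall>\<^sub>F y in inf (nhds z) (filtermap f \<omega>). False"
        unfolding eventually_inf by blast
      then show False using z by (simp add: trivial_limit_def)
    qed
    then show ?thesis by (auto intro!: exI[of _ z] topological_tendstoI)
  qed
  then obtain g where g: "\<And>\<omega>. ultrafilter \<omega> \<Longrightarrow> (f \<longlongrightarrow> g \<omega>) \<omega>" by metis
  show thesis
  proof (rule that)
    show "(f \<longlongrightarrow> g \<omega>) \<omega>" if "\<omega> \<in> topspace beta_nat" for \<omega>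
      using that g by (simp add: topspace_beta_nat)
    show "g (principal {n}) = f n" for n
    proof (rule tendsto_unique[OF _ g[OF ultrafilter_principal]])
      show "principal {n} \<noteq> bot" by (simp add: principal_eq_bot_iff)
      show "(f \<longlongrightarrow> f n) (principal {n})"
        by (rule topological_tendstoI) (simp add: eventually_principal)
    qed
    show "continuous_map beta_nat euclidean g"
      unfolding continuous_map_def
    proof (intro conjI allI impI)
      fix V :: "complex set" assume "openin euclidean V"
      then have V: "open V" by simp
      show "openin beta_nat {\<omega> \<in> topspace beta_nat. g \<omega> \<in> V}"
      proof (subst openin_subopen, intro ballI)
        fix \<omega> assume "\<omega> \<in> {\<omega> \<in> topspace beta_nat. g \<omega> \<in> V}"
        then have \<omega>: "ultrafilter \<omega>" "g \<omega> \<in> V" by (auto simp: topspace_beta_nat)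
        then obtain e where e: "e > 0" "cball (g \<omega>) e \<subseteq> V" using V open_contains_cball by blast
        let ?W = "{F. ultrafilter F \<and> (\<forall>\<^sub>F n in F. n \<in> f -` cball (g \<omega>) e)}"
        have "\<forall>\<^sub>F n in \<omega>. f n \<in> ball (g \<omega>) e"
          using g[OF \<omega>(1)] e(1) by (intro topological_tendstoD) auto
        then have "\<omega> \<in> ?W" using \<omega>(1) by (auto elim: eventually_mono)
        moreover have "?W \<subseteq> {\<omega> \<in> topspace beta_nat. g \<omega> \<in> V}"
        proof
          fix F assume F: "F \<in> ?W"
          then have "g F \<in> cball (g \<omega>) e"
            using g[of F] by (intro Lim_in_closed_set[of _ f F]) (auto simp: ultrafilter_def)
          then show "F \<in> {\<omega> \<in> topspace beta_nat. g \<omega> \<in> V}"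
            using F e by (auto simp: topspace_beta_nat)
        qed
        ultimately show "\<exists>T. openin beta_nat T \<and> \<omega> \<in> T \<and> T \<subseteq> {\<omega> \<in> topspace beta_nat. g \<omega> \<in> V}"
          using openin_beta_nat_basic by blast
      qed
    qed simp
  qed
qed

lemma beta_ext:
  assumes "bounded (range f)"
  shows "continuous_map beta_nat euclidean (beta_ext f)" "beta_ext f (principal {n}) = f n"
    "\<omega> \<in> topspace beta_nat \<Longrightarrow> (f \<longlongrightarrow> beta_ext f \<omega>) \<omega>"
proof -
  obtain g where g: "continuous_map beta_nat euclidean g" "\<And>n. g (principal {n}) = f n"
    "\<And>\<omega>. \<omega> \<in> topspace beta_nat \<Longrightarrow> (f \<longlongrightarrow> g \<omega>) \<omega>"
    using beta_ext_exists[OF assms] by blast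
  have eq: "beta_ext f \<omega> = g \<omega>" if "\<omega> \<in> topspace beta_nat" for \<omega>
    unfolding beta_ext_def
  proof (rule the_equality)
    show "\<exists>h. continuous_map beta_nat euclidean h \<and> (\<forall>n. h (principal {n}) = f n) \<and> h \<omega> = g \<omega>"
      using g by blast
    fix z assume "\<exists>h. continuous_map beta_nat euclidean h \<and> (\<forall>n. h (principal {n}) = f n) \<and> h \<omega> = z"
    then obtain h where h: "continuous_map beta_nat euclidean h" "\<And>n. h (principal {n}) = f n" "h \<omega> = z"
      by blast
    have "h \<omega> = g \<omega>" by (rule beta_ext_unique[OF h(1) g(1) _ that]) (simp add: h(2) g(2))
    then show "z = g \<omega>" using h(3) by simp
  qed
  show "continuous_map beta_nat euclidean (beta_ext f)"
    by (rule continuous_map_eq[OF g(1)]) (simp add: eq)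
  show "beta_ext f (principal {n}) = f n"
    using eq g(2) by (simp add: topspace_beta_nat ultrafilter_principal)
  show "\<omega> \<in> topspace beta_nat \<Longrightarrow> (f \<longlongrightarrow> beta_ext f \<omega>) \<omega>"
    using eq g(3) by simp
qed

section \<open>States and the Kadison-Singer conjecture\<close>

definition state :: "(bop \<Rightarrow> complex) \<Rightarrow> bool" where
  "state \<phi> \<longleftrightarrow> (\<forall>S T. \<phi> (S + T) = \<phi> S + \<phi> T) \<and> (\<forall>c T. \<phi> (c *\<^sub>C T) = c * \<phi> T)
     \<and> (\<forall>T. positive_op T \<longrightarrow> 0 \<le> \<phi> T) \<and> \<phi> 1 = 1"

text \<open>\<open>point_state \<omega>\<close> is the pure state \<open>s\<^sub>\<omega>\<close> of the diagonal algebra: a diagonal operator is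
  identified with its diagonal sequence. It is only used on \<open>diagonals\<close>.\<close>

definition point_state :: "nat filter \<Rightarrow> bop \<Rightarrow> complex" where
  "point_state \<omega> D = beta_ext (\<lambda>n. entry D n n) \<omega>"

definition kadison_singer :: bool where
  "kadison_singer \<longleftrightarrow>
    (\<forall>\<omega>\<in>topspace beta_nat. \<exists>!\<phi>. state \<phi> \<and> (\<forall>D\<in>diagonals. \<phi> D = point_state \<omega> D))"

end

theory Submission
  imports Defs
begin

text \<open>The Kadison-Singer property is equivalent to paving: \<open>s\<^sub>\<omega>\<close> has a unique extension exactly
  when every self-adjoint \<open>H\<close> with zero diagonal becomes arbitrarily small under compression to suitable
  sets of \<open>\<omega>\<close>, and compactness of \<open>\<beta>\<nat>\<close> turns one good set per ultrafilter into a finite paving. Pavings of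
  \<open>P - E(P)\<close> and \<open>P\<inverse> - E(P\<inverse>)\<close>, refined so that both diagonals are almost constant, give (iv), because
  the diagonal entries satisfy \<open>p\<^sub>n q\<^sub>n \<ge> 1\<close>. Conversely (v) is applied to \<open>P = 1 + t H\<close>, where \<open>P\<inverse>\<close> has
  diagonal \<open>1 + O(t\<^sup>2)\<close>; this forces \<open>t H \<ge> - O(t\<^sup>2)\<close> on each block. The uniform versions follow by
  taking the direct sum of a sequence of counterexamples over \<open>\<nat> \<times> \<nat> \<cong> \<nat>\<close>.\<close>

section \<open>Self-adjoint operators and compressions\<close>

text \<open>Composing s_\<omega> with E always gives one extension, so only uniqueness is at stake:
  every extension must vanish on self-adjoint operators with zero diagonal. If H takes values below
  -\<epsilon> on unit vectors supported in each set of \<omega>, the vector states at such vectors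
  have a limit that sees diagonal operators only through \<omega>, yet has real part at most
  -\<epsilon> at H. Conversely, an extension gives mass 0 to the complement of a set of \<omega>, so
  a form bound on that set alone controls its value. Since -H satisfies the same hypotheses as H,
  lower bounds suffice throughout.

  In the return from (v), H enters P linearly in t while the tolerance and the excess of the
  diagonal of the inverse are quadratic; dividing by t leaves an error of order t.

  For uniformity the r-th summand is chosen to defeat every r-paving, and a paving of the sum
  restricts to each summand with the same number of sets. The sum must be bounded: the H are scaled
  to norm at most 1, while for P the order interval is recentred into a norm ball.\<close>

lemma adjI: "(\<And>x y. cinner (app S x) y = cinner x (app T y)) \<Longrightarrow> adj T = S"
  unfolding adj_def by (rule the1_equality[OF adj_ex1]) simp

lemma self_adj_iff: "adj T = T \<longleftrightarrow> (\<forall>x y. cinner (app T x) y = cinner x (app T y))"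
  using adjI[of T T] cinner_adj[of T] by metis

lemma cinner_adj_right: "cinner x (app (adj T) y) = cinner (app T x) y"
  by (metis cinner_adj cinner_commute)

lemma adj_add: "adj (S + T) = adj S + adj T"
  by (rule adjI) (simp add: cinner_add_left cinner_add_right cinner_adj)

lemma adj_diff: "adj (S - T) = adj S - adj T"
  by (rule adjI) (simp add: cinner_diff_left cinner_diff_right cinner_adj)

lemma adj_minus: "adj (- T) = - adj T"
  by (rule adjI) (simp add: cinner_minus_left cinner_minus_right cinner_adj)

lemma adj_scaleC: "adj (c *\<^sub>C T) = cnj c *\<^sub>C adj T"
  by (rule adjI) (simp add: cinner_scaleC_left cinner_scaleC_right cinner_adj)

lemma adj_scaleR: "adj (r *\<^sub>R T) = r *\<^sub>R adj T"
  by (simp add: scaleR_scaleC adj_scaleC)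

lemma adj_mult: "adj (S * T) = adj T * adj S"
  by (rule adjI) (simp add: cinner_adj)

lemma adj_adj: "adj (adj T) = T"
  by (rule adjI) (simp add: cinner_adj_right)

lemma adj_one [simp]: "adj 1 = 1"
  by (rule adjI) simp

text \<open>Nonnegativity in the complex order includes reality of the quadratic form. Over complex
  scalars the form determines the operator, so \<open>adj T - T\<close> vanishes because its form
  does.\<close>

lemma nonneg_imp_self_adj:
  assumes "0 \<le> T"
  shows "adj T = T"
proof -
  have "cinner (app T x) x \<in> \<real>" for x
    using assms by (simp add: less_eq_bop_def positive_op_def less_eq_complex_def complex_is_Real_iff)
  then have "cinner (app (adj T - T) x) x = 0" for x
    by (metis app_simps(4) cinner_adj cinner_commute cinner_diff_left Reals_cnj_iff
        diff_self)
  then show ?thesis using bop_quadratic_zero[of "adj T - T"] by simp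
qed

lemma self_adj_quadratic_real:
  assumes "adj T = T"
  shows "cinner (app T x) x = complex_of_real (inner (app T x) x)"
proof -
  have "cinner (app T x) x = cnj (cinner (app T x) x)"
    using assms by (metis cinner_commute cinner_adj)
  then have "Im (cinner (app T x) x) = 0" by (metis Reals_cnj_iff complex_is_Real_iff)
  then show ?thesis by (simp add: inner_ell2_def complex_eq_iff)
qed

text \<open>The forms of self-adjoint operators are real, so the complex order reduces to the real
  inner product, in which the later estimates are carried out.\<close>

lemma le_bop_iff:
  assumes "adj S = S" "adj T = T"
  shows "S \<le> T \<longleftrightarrow> (\<forall>x. inner (app S x) x \<le> inner (app T x) x)"
proof -
  have "adj (T - S) = T - S" using assms by (simp add: adj_diff)
  then show ?thesis
    unfolding less_eq_bop_def positive_op_def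
    by (subst self_adj_quadratic_real) (auto simp: inner_diff_left less_eq_complex_def)
qed

lemma adj_zero [simp]: "adj 0 = 0"
  by (rule adjI) simp

lemma quadratic_diff:
  fixes x y :: ell2
  assumes "adj T = T"
  shows "4 * inner (app T x) y = inner (app T (x + y)) (x + y) - inner (app T (x - y)) (x - y)"
proof -
  interpret bounded_linear "app T" by (rule bounded_linear_app)
  have "inner (app T y) x = inner (app T x) y"
    using assms by (metis cinner_adj inner_commute inner_ell2_def)
  then show ?thesis
    by (simp add: add diff inner_add_left inner_add_right inner_diff_left inner_diff_right)
qed

lemma norm_bop_le:
  assumes "0 \<le> K" "\<And>x. norm (app T x) \<le> K * norm x"
  shows "norm T \<le> K"
  using assms by transfer (rule norm_blinfun_bound)

text \<open>The norm of a self-adjoint operator is controlled by its numerical radius: polarise,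
  bound both terms by the hypothesis, and apply the parallelogram law.\<close>

lemma self_adj_norm_le:
  assumes sa: "adj T = T" and e: "0 \<le> e" and q: "\<And>x. \<bar>inner (app T x) x\<bar> \<le> e * (norm x)\<^sup>2"
  shows "norm T \<le> e"
proof (rule norm_bop_le[OF e])
  fix x
  show "norm (app T x) \<le> e * norm x"
  proof (cases "x = 0 \<or> app T x = 0")
    case True
    then show ?thesis using e linear_0[OF bounded_linear.linear[OF bounded_linear_app]] by auto
  next
    case False
    \<comment> \<open>The vector \<open>y\<close> points along \<open>app T x\<close> but has the
      length of \<open>x\<close>; this turns the polarised form into
      \<open>norm (app T x) * norm x\<close>.\<close>
    define s where "s = norm x / norm (app T x)"
    define y where "y = s *\<^sub>R app T x"
    have s: "s > 0" and ny: "norm y = norm x" using False by (auto simp: s_def y_def)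
    have "4 * inner (app T x) y \<le> e * (norm (x + y))\<^sup>2 + e * (norm (x - y))\<^sup>2"
      unfolding quadratic_diff[OF sa] using q[of "x + y"] q[of "x - y"] by linarith
    also have "\<dots> = e * (2 * (norm x)\<^sup>2 + 2 * (norm y)\<^sup>2)"
      by (simp add: power2_norm_eq_inner inner_add_left inner_add_right inner_diff_left
          inner_diff_right inner_commute algebra_simps)
    also have "\<dots> = 4 * (e * norm x) * norm x" by (simp add: ny power2_eq_square)
    finally have "inner (app T x) y \<le> e * norm x * norm x" by simp
    moreover have "inner (app T x) y = norm (app T x) * norm x"
      using False by (simp add: y_def s_def power2_norm_eq_inner[symmetric] power2_eq_square)
    ultimately show ?thesis using False by simp
  qed
qed

lemma abs_inner_app_le: "\<bar>inner (app T x) x\<bar> \<le> norm T * (norm x)\<^sup>2"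
proof -
  have "\<bar>inner (app T x) x\<bar> \<le> norm (app T x) * norm x" by (rule Cauchy_Schwarz_ineq2)
  also have "\<dots> \<le> norm T * norm x * norm x" by (intro mult_right_mono app_norm_le) simp
  finally show ?thesis by (simp add: power2_eq_square mult.assoc)
qed

section \<open>Matrix entries, the conditional expectation and diagonal projections\<close>

lemma coord_eq_cinner: "coord x n = cinner x (basis_vec n)"
  unfolding cinner_def using suminf_finite[of "{n}" "\<lambda>k. coord x k * cnj (coord (basis_vec n) k)"]
  by (simp add: coord_basis_vec)

lemma norm_basis_vec [simp]: "norm (basis_vec n) = 1"
  unfolding norm_ell2_def using suminf_finite[of "{n}" "\<lambda>k. (cmod (coord (basis_vec n) k))\<^sup>2"]
  by (simp add: coord_basis_vec)

lemma cmod_coord_le: "cmod (coord x n) \<le> norm x"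
  using cmod_cinner_le[of x "basis_vec n"] by (simp add: coord_eq_cinner)

lemma norm_le_coord:
  assumes "0 \<le> K" "\<And>n. cmod (coord y n) \<le> K * cmod (coord x n)"
  shows "norm y \<le> K * norm x"
proof (rule power2_le_imp_le)
  have "(\<Sum>n. (cmod (coord y n))\<^sup>2) \<le> (\<Sum>n. K\<^sup>2 * (cmod (coord x n))\<^sup>2)"
    using assms(2) by (intro suminf_le coord_summable summable_mult)
      (auto simp flip: power_mult_distrib intro!: power_mono)
  then show "(norm y)\<^sup>2 \<le> (K * norm x)\<^sup>2"
    by (simp add: norm_sq_ell2 suminf_mult[OF coord_summable] power_mult_distrib)
qed (use assms(1) in simp)

lemma bop_eq_basis:
  assumes "\<And>n. app S (basis_vec n) = app T (basis_vec n)"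
  shows "S = T"
proof (rule bop_eqI)
  fix x
  have "(\<lambda>N. app S (trunc N (coord x))) = (\<lambda>N. app T (trunc N (coord x)))"
    by (simp add: app_trunc assms)
  then show "app S x = app T x"
    using bounded_linear.tendsto[OF bounded_linear_app trunc_tendsto, of S x]
      bounded_linear.tendsto[OF bounded_linear_app trunc_tendsto, of T x]
    by (metis LIMSEQ_unique)
qed

lemma bop_eq_entry:
  assumes "\<And>i j. entry S i j = entry T i j"
  shows "S = T"
  by (rule bop_eq_basis, rule ell2_eqI) (use assms in \<open>simp add: entry_def\<close>)

lemma entry_eq_cinner: "entry T i j = cinner (app T (basis_vec j)) (basis_vec i)"
  by (simp add: entry_def coord_eq_cinner)

lemma entry_simps [simp]:
  "entry (S + T) i j = entry S i j + entry T i j" "entry (S - T) i j = entry S i j - entry T i j"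
  "entry (- T) i j = - entry T i j" "entry (c *\<^sub>C T) i j = c * entry T i j"
  "entry (r *\<^sub>R T) i j = complex_of_real r * entry T i j"
  "entry 0 i j = 0" "entry 1 i j = (if i = j then 1 else 0)"
  by (simp_all add: entry_def coord_basis_vec)

lemma entry_adj: "entry (adj T) i j = cnj (entry T j i)"
  by (metis entry_eq_cinner cinner_adj cinner_commute)

lemma cmod_entry_le: "cmod (entry T i j) \<le> norm T"
  using order_trans[OF cmod_coord_le app_norm_le[of T "basis_vec j"]] by (simp add: entry_def)

lemma coord_cond_exp: "coord (app (cond_exp T) x) n = entry T n n * coord x n"
  unfolding cond_exp_def by (rule coord_diag[OF bounded_entries])

lemma entry_cond_exp: "entry (cond_exp T) i j = (if i = j then entry T i i else 0)"
  by (simp add: entry_def[of "cond_exp T"] coord_cond_exp coord_basis_vec)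

lemma cond_exp_eq_0_iff: "cond_exp T = 0 \<longleftrightarrow> (\<forall>n. entry T n n = 0)"
  by (metis bop_eq_entry entry_cond_exp entry_simps(6))

lemma cond_exp_in_diagonals: "cond_exp T \<in> diagonals"
  by (simp add: diagonals_def entry_cond_exp)

lemma diagonals_cond_exp: "D \<in> diagonals \<Longrightarrow> cond_exp D = D"
  by (rule bop_eq_entry) (simp add: entry_cond_exp diagonals_def)

lemma coord_diag_proj: "coord (app (diag_proj A) x) n = (if n \<in> A then coord x n else 0)"
  unfolding diag_proj_def by (subst coord_diag) (auto simp: bounded_iff intro!: exI[of _ 1])

lemma entry_diag_proj: "entry (diag_proj A) i j = (if i = j \<and> i \<in> A then 1 else 0)"
  by (auto simp: entry_def coord_diag_proj coord_basis_vec)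

lemma adj_diag_proj [simp]: "adj (diag_proj A) = diag_proj A"
  by (rule bop_eq_entry) (auto simp: entry_adj entry_diag_proj)

lemma diag_proj_idem: "app (diag_proj A) (app (diag_proj A) x) = app (diag_proj A) x"
  by (rule ell2_eqI) (simp add: coord_diag_proj)

lemma norm_diag_proj_le: "norm (app (diag_proj A) x) \<le> norm x"
  using norm_le_coord[of 1 "app (diag_proj A) x" x] by (simp add: coord_diag_proj)

lemma diag_proj_compl: "app (diag_proj (- A)) x = x - app (diag_proj A) x"
  by (rule ell2_eqI) (simp add: coord_diag_proj)

lemma inner_diag_proj: "inner (app (diag_proj A) x) y = inner (app (diag_proj A) x) (app (diag_proj A) y)"
  unfolding inner_ell2_def by (metis cinner_adj adj_diag_proj diag_proj_idem)

section \<open>Form bounds on coordinate subspaces\<close>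

definition supported :: "nat set \<Rightarrow> ell2 \<Rightarrow> bool" where
  "supported A x \<longleftrightarrow> (\<forall>n. n \<notin> A \<longrightarrow> coord x n = 0)"

lemma supported_mono: "supported A x \<Longrightarrow> A \<subseteq> B \<Longrightarrow> supported B x"
  by (auto simp: supported_def)

lemma supported_diag_proj [simp]: "supported A (app (diag_proj A) x)"
  by (simp add: supported_def coord_diag_proj)

lemma diag_proj_supported: "supported A x \<Longrightarrow> app (diag_proj A) x = x"
  by (rule ell2_eqI) (auto simp: supported_def coord_diag_proj)

text \<open>This form of a compression inequality mentions no projection, so heredity in
  \<open>A\<close> and additivity in \<open>X\<close> are immediate. Upper bounds are expressed
  through \<open>- X\<close>.\<close>

definition below_on :: "bop \<Rightarrow> real \<Rightarrow> nat set \<Rightarrow> bool" where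
  "below_on X c A \<longleftrightarrow> (\<forall>x. supported A x \<longrightarrow> c * (norm x)\<^sup>2 \<le> inner (app X x) x)"

lemma below_on_mono: "below_on X c A \<Longrightarrow> B \<subseteq> A \<Longrightarrow> below_on X c B"
  by (auto simp: below_on_def dest: supported_mono)

lemma below_on_weaken: "below_on X c A \<Longrightarrow> d \<le> c \<Longrightarrow> below_on X d A"
  unfolding below_on_def by (meson mult_right_mono order_trans zero_le_power2)

lemma below_on_add: "below_on X c A \<Longrightarrow> below_on Y d A \<Longrightarrow> below_on (X + Y) (c + d) A"
  by (fastforce simp: below_on_def inner_add_left distrib_right intro: add_mono)

lemma inner_compression:
  "inner (app (diag_proj A * X * diag_proj A) x) x
    = inner (app X (app (diag_proj A) x)) (app (diag_proj A) x)"
  by (simp add: inner_ell2_def) (metis cinner_adj adj_diag_proj)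

lemma adj_compression: "adj X = X \<Longrightarrow> adj (diag_proj A * X * diag_proj A) = diag_proj A * X * diag_proj A"
  by (simp add: adj_mult mult.assoc)

lemma below_on_iff:
  assumes "adj X = X"
  shows "c *\<^sub>R diag_proj A \<le> diag_proj A * X * diag_proj A \<longleftrightarrow> below_on X c A"
proof -
  have "c *\<^sub>R diag_proj A \<le> diag_proj A * X * diag_proj A \<longleftrightarrow>
    (\<forall>x. c * (norm (app (diag_proj A) x))\<^sup>2
      \<le> inner (app X (app (diag_proj A) x)) (app (diag_proj A) x))"
    using assms
    by (subst le_bop_iff)
      (auto simp: adj_scaleR adj_compression inner_compression inner_diag_proj[of A x x for x]
        power2_norm_eq_inner simp del: app_simps(8))
  also have "\<dots> \<longleftrightarrow> below_on X c A"
    unfolding below_on_def by (metis diag_proj_supported supported_diag_proj)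
  finally show ?thesis .
qed

lemma below_on_minus_iff:
  assumes "adj X = X"
  shows "diag_proj A * X * diag_proj A \<le> c *\<^sub>R diag_proj A \<longleftrightarrow> below_on (- X) (- c) A"
proof -
  have "diag_proj A * X * diag_proj A \<le> c *\<^sub>R diag_proj A \<longleftrightarrow>
    (- c) *\<^sub>R diag_proj A \<le> diag_proj A * (- X) * diag_proj A"
    by simp
  then show ?thesis using below_on_iff[of "- X" "- c" A] assms by (simp add: adj_minus)
qed

section \<open>Finite covers and ultrafilters\<close>

text \<open>Overlaps are allowed: for properties inherited by subsets this agrees with the existence
  of a paving, while covers are easier to refine jointly and come directly out of
  compactness.\<close>

definition finitely_covers :: "(nat set \<Rightarrow> bool) \<Rightarrow> bool" where
  "finitely_covers Q \<longleftrightarrow> (\<exists>\<C>. finite \<C> \<and> \<Union>\<C> = UNIV \<and> (\<forall>C\<in>\<C>. Q C))"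

lemma finitely_covers_mono: "finitely_covers Q \<Longrightarrow> (\<And>A. Q A \<Longrightarrow> R A) \<Longrightarrow> finitely_covers R"
  unfolding finitely_covers_def by blast

lemma finitely_covers_conj:
  assumes "finitely_covers Q" "finitely_covers R"
    and Q: "\<And>A B. Q A \<Longrightarrow> B \<subseteq> A \<Longrightarrow> Q B" and R: "\<And>A B. R A \<Longrightarrow> B \<subseteq> A \<Longrightarrow> R B"
  shows "finitely_covers (\<lambda>A. Q A \<and> R A)"
proof -
  obtain \<C> \<D> where C: "finite \<C>" "\<Union>\<C> = UNIV" "\<And>C. C \<in> \<C> \<Longrightarrow> Q C"
    and D: "finite \<D>" "\<Union>\<D> = UNIV" "\<And>C. C \<in> \<D> \<Longrightarrow> R C"
    using assms(1,2) unfolding finitely_covers_def by metis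
  let ?E = "(\<lambda>(C, D). C \<inter> D) ` (\<C> \<times> \<D>)"
  have "finite ?E" using C D by simp
  moreover have "\<Union>?E = UNIV"
  proof -
    have "\<exists>C\<in>\<C>. n \<in> C" "\<exists>D\<in>\<D>. n \<in> D" for n using C(2) D(2) by auto
    then show ?thesis by (simp add: set_eq_iff)
  qed
  moreover have "\<forall>E\<in>?E. Q E \<and> R E"
  proof
    fix E assume "E \<in> ?E"
    then obtain C D where "C \<in> \<C>" "D \<in> \<D>" "E = C \<inter> D" by auto
    then show "Q E \<and> R E" using C(3) D(3) Q[of C E] R[of D E] by auto
  qed
  ultimately show ?thesis unfolding finitely_covers_def by blast
qed

lemma finitely_covers_iff_paving:
  assumes Q: "\<And>A B. Q A \<Longrightarrow> B \<subseteq> A \<Longrightarrow> Q B"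
  shows "finitely_covers Q \<longleftrightarrow> (\<exists>r A. paving r A \<and> (\<forall>i\<in>{1..r}. Q (A i)))"
proof
  assume "finitely_covers Q"
  then obtain \<C> where C: "finite \<C>" "\<Union>\<C> = UNIV" "\<And>C. C \<in> \<C> \<Longrightarrow> Q C"
    unfolding finitely_covers_def by metis
  obtain f where "bij_betw f {1..card \<C>} \<C>"
    using finite_same_card_bij[of "{1..card \<C>}" \<C>] C(1) by auto
  then have f: "f ` {1..card \<C>} = \<C>" by (simp add: bij_betw_def)
  \<comment> \<open>Removing the earlier sets makes the cover disjoint; \<open>Q\<close> survives
    because it is hereditary. A point then lies in the piece of its least index.\<close>
  define A where "A i = f i - (\<Union>j\<in>{1..<i}. f j)" for i
  have "\<exists>i\<in>{1..card \<C>}. n \<in> A i" for n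
  proof -
    have ex: "\<exists>i. i \<in> {1..card \<C>} \<and> n \<in> f i"
      using C(2) f by (metis UNIV_I UnionE imageE)
    define i where "i = (LEAST i. i \<in> {1..card \<C>} \<and> n \<in> f i)"
    have i: "i \<in> {1..card \<C>} \<and> n \<in> f i" unfolding i_def by (rule LeastI_ex[OF ex])
    moreover have "n \<notin> f j" if "j \<in> {1..<i}" for j
      using not_less_Least[of j "\<lambda>i. i \<in> {1..card \<C>} \<and> n \<in> f i"] that i by (auto simp: i_def)
    ultimately show ?thesis by (auto simp: A_def)
  qed
  then have "(\<Union>i\<in>{1..card \<C>}. A i) = UNIV" by blast
  moreover have "disjoint_family_on A {1..card \<C>}"
  proof -
    have "A i \<inter> A j = {}" if "1 \<le> i" "i < j" for i j using that by (auto simp: A_def)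
    then have "A i \<inter> A j = {}" if "1 \<le> i" "1 \<le> j" "i \<noteq> j" for i j
      using that by (metis Int_commute linorder_neqE_nat)
    then show ?thesis by (simp add: disjoint_family_on_def)
  qed
  moreover have "Q (A i)" if "i \<in> {1..card \<C>}" for i
  proof (rule Q)
    show "Q (f i)" using C(3) f that by blast
    show "A i \<subseteq> f i" by (auto simp: A_def)
  qed
  ultimately show "\<exists>r A. paving r A \<and> (\<forall>i\<in>{1..r}. Q (A i))" unfolding paving_def by blast
next
  assume "\<exists>r A. paving r A \<and> (\<forall>i\<in>{1..r}. Q (A i))"
  then obtain r A where "paving r A" "\<forall>i\<in>{1..r}. Q (A i)" by blast
  then show "finitely_covers Q"
    unfolding finitely_covers_def paving_def by (intro exI[of _ "A ` {1..r}"]) auto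
qed

lemma ultrafilter_finite_Union:
  assumes "ultrafilter \<omega>" "finite \<C>" "\<Union>\<C> = UNIV"
  shows "\<exists>C\<in>\<C>. \<forall>\<^sub>F n in \<omega>. n \<in> C"
proof (rule ccontr)
  assume "\<not> ?thesis"
  then have "\<forall>\<^sub>F n in \<omega>. \<forall>C\<in>\<C>. n \<notin> C"
    using ultrafilter_not[OF assms(1)] assms(2) by (subst eventually_ball_finite_distrib) blast+
  moreover have "\<not> (\<forall>C\<in>\<C>. n \<notin> C)" for n using assms(3) by blast
  ultimately have "\<forall>\<^sub>F n in \<omega>. False" by simp
  then show False using assms(1) by (simp add: ultrafilter_def)
qed

text \<open>Local-to-global principle by compactness of \<beta>\<nat>: one good set per ultrafilter
  gives an open cover by basic sets, and a finite subcover descends to the natural numbers.\<close>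

lemma finitely_covers_iff_ultrafilter:
  "finitely_covers Q \<longleftrightarrow> (\<forall>\<omega>. ultrafilter \<omega> \<longrightarrow> (\<exists>A. Q A \<and> (\<forall>\<^sub>F n in \<omega>. n \<in> A)))"
proof
  assume "finitely_covers Q"
  then show "\<forall>\<omega>. ultrafilter \<omega> \<longrightarrow> (\<exists>A. Q A \<and> (\<forall>\<^sub>F n in \<omega>. n \<in> A))"
    unfolding finitely_covers_def by (metis ultrafilter_finite_Union)
next
  assume ex: "\<forall>\<omega>. ultrafilter \<omega> \<longrightarrow> (\<exists>A. Q A \<and> (\<forall>\<^sub>F n in \<omega>. n \<in> A))"
  let ?U = "\<lambda>A. {F :: nat filter. ultrafilter F \<and> (\<forall>\<^sub>F n in F. n \<in> A)}"
  have "topspace beta_nat \<subseteq> \<Union>(?U ` Collect Q)"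
    using ex by (fastforce simp: topspace_beta_nat)
  moreover have "\<forall>U\<in>?U ` Collect Q. openin beta_nat U"
    using openin_beta_nat_basic by blast
  ultimately obtain \<F> where "finite \<F>" "\<F> \<subseteq> ?U ` Collect Q" and cov: "topspace beta_nat \<subseteq> \<Union>\<F>"
    using compact_beta_nat unfolding compact_space_alt by meson
  then obtain \<C> where C: "finite \<C>" "\<C> \<subseteq> Collect Q" "\<F> = ?U ` \<C>"
    by (meson finite_subset_image)
  \<comment> \<open>The subcover is tested at the principal ultrafilter of \<open>n\<close>, which
    belongs to the basic set of \<open>A\<close> exactly when \<open>n\<close> belongs to
    \<open>A\<close>.\<close>
  have "n \<in> \<Union>\<C>" for n
  proof -
    have "principal {n} \<in> \<Union>\<F>"
      by (rule subsetD[OF cov]) (simp add: topspace_beta_nat ultrafilter_principal)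
    then show ?thesis unfolding C(3) by (auto simp: eventually_principal)
  qed
  then show "finitely_covers Q"
    unfolding finitely_covers_def using C by (intro exI[of _ \<C>]) auto
qed

text \<open>Compactness yields a cluster point, and along an ultrafilter a cluster point is a limit:
  a neighbourhood that is not eventually entered is eventually avoided.\<close>

lemma ultrafilter_compact_tendsto:
  fixes f :: "'a \<Rightarrow> 'b::topological_space"
  assumes U: "ultrafilter U" and K: "compact K" and ev: "\<forall>\<^sub>F x in U. f x \<in> K"
  obtains z where "(f \<longlongrightarrow> z) U"
proof -
  have "filtermap f U \<noteq> bot" using U by (simp add: ultrafilter_def filtermap_bot_iff)
  moreover have "\<forall>\<^sub>F z in filtermap f U. z \<in> K" using ev by (simp add: eventually_filtermap)
  ultimately obtain z where z: "inf (nhds z) (filtermap f U) \<noteq> bot"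
    using K unfolding compact_filter by blast
  have "\<forall>\<^sub>F x in U. f x \<in> S" if S: "open S" "z \<in> S" for S
  proof (rule ccontr)
    assume "\<not> ?thesis"
    then have "\<forall>\<^sub>F y in filtermap f U. y \<notin> S"
      using ultrafilter_not[OF U] by (simp add: eventually_filtermap)
    moreover have "\<forall>\<^sub>F y in nhds z. y \<in> S" using S by (simp add: eventually_nhds_in_open)
    ultimately have "\<forall>\<^sub>F y in inf (nhds z) (filtermap f U). False"
      unfolding eventually_inf by blast
    then show False using z by (simp add: trivial_limit_def)
  qed
  then show thesis by (intro that topological_tendstoI)
qed

lemma closed_nonneg_complex: "closed {z :: complex. 0 \<le> z}"
proof -
  have "{z :: complex. 0 \<le> z} = {z. 0 \<le> Re z} \<inter> {z. Im z = 0}"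
    by (auto simp: less_eq_complex_def)
  moreover have "closed {z. Im z = 0}"
    by (intro closed_Collect_eq continuous_intros)
  ultimately show ?thesis
    by (metis closed_Int closed_halfspace_Re_ge)
qed

text \<open>Here \<open>U\<close> is an ultrafilter on vectors, not on indices. Vector states
  converge pointwise along it since their values at \<open>T\<close> stay in the disc of radius
  \<open>norm T\<close>; this takes the place of weak-* compactness of the state space.\<close>

lemma vector_state_limit:
  assumes U: "ultrafilter U" and ev: "\<forall>\<^sub>F x in U. norm x = 1"
  obtains \<phi> where "state \<phi>" "\<And>T. ((\<lambda>x. cinner (app T x) x) \<longlongrightarrow> \<phi> T) U"
proof -
  have ne: "U \<noteq> bot" using U by (simp add: ultrafilter_def)
  have "\<exists>z. ((\<lambda>x. cinner (app T x) x) \<longlongrightarrow> z) U" for T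
  proof (rule ultrafilter_compact_tendsto[OF U])
    show "compact (cball (0 :: complex) (norm T))" by simp
    show "\<forall>\<^sub>F x in U. cinner (app T x) x \<in> cball 0 (norm T)"
      using ev
    proof eventually_elim
      case (elim x)
      then show ?case using order_trans[OF cmod_cinner_le[of "app T x" x]] app_norm_le[of T x] by simp
    qed
  qed blast
  then obtain \<phi> where \<phi>: "((\<lambda>x. cinner (app T x) x) \<longlongrightarrow> \<phi> T) U" for T by metis
  have "state \<phi>"
    unfolding state_def
  proof (intro conjI allI impI)
    fix S T c
    show "\<phi> (S + T) = \<phi> S + \<phi> T"
      by (rule tendsto_unique[OF ne \<phi>])
        (use tendsto_add[OF \<phi>[of S] \<phi>[of T]] in \<open>simp add: cinner_add_left\<close>)
    show "\<phi> (c *\<^sub>C T) = c * \<phi> T"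
      by (rule tendsto_unique[OF ne \<phi>])
        (use tendsto_mult_left[OF \<phi>[of T], of c] in \<open>simp add: cinner_scaleC_left\<close>)
    show "0 \<le> \<phi> T" if "positive_op T"
      using Lim_in_closed_set[OF closed_nonneg_complex _ ne \<phi>[of T]] that
      by (simp add: positive_op_def)
  next
    have "((\<lambda>x. cinner (app 1 x) x) \<longlongrightarrow> 1) U"
      by (rule tendsto_eventually, rule eventually_mono[OF ev]) (simp add: cinner_self_norm)
    then show "\<phi> 1 = 1" using \<phi>[of 1] tendsto_unique[OF ne] by blast
  qed
  then show thesis using that \<phi> by blast
qed

section \<open>States extending a point evaluation\<close>

text \<open>One-sided paving, stated with covers. Applying it to \<open>- H\<close> and refining
  recovers the two-sided bound.\<close>

definition pavable :: bool where
  "pavable \<longleftrightarrow> (\<forall>H \<epsilon>. adj H = H \<longrightarrow> cond_exp H = 0 \<longrightarrow> \<epsilon> > 0 \<longrightarrow> finitely_covers (below_on H (- \<epsilon>)))"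

lemma point_state_tendsto:
  assumes "ultrafilter \<omega>"
  shows "((\<lambda>n. entry T n n) \<longlongrightarrow> point_state \<omega> T) \<omega>"
  unfolding point_state_def
  by (rule beta_ext(3)[OF bounded_entries]) (simp add: topspace_beta_nat assms)

lemma point_state_eqI:
  assumes "ultrafilter \<omega>" "((\<lambda>n. entry T n n) \<longlongrightarrow> z) \<omega>"
  shows "point_state \<omega> T = z"
  using assms tendsto_unique[OF _ point_state_tendsto] by (auto simp: ultrafilter_def)

text \<open>\<open>point_state\<close> reads only diagonal entries, so on all of \<open>bop\<close>
  it is the composition of s_\<omega> with E. This supplies the existence half of the Kadison-Singer
  property.\<close>

lemma state_point_state:
  assumes U: "ultrafilter \<omega>"
  shows "state (point_state \<omega>)"
  unfolding state_def
proof (intro conjI allI impI)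
  note lim = point_state_tendsto[OF U]
  fix S T c
  show "point_state \<omega> (S + T) = point_state \<omega> S + point_state \<omega> T"
    by (rule point_state_eqI[OF U]) (use tendsto_add[OF lim[of S] lim[of T]] in simp)
  show "point_state \<omega> (c *\<^sub>C T) = c * point_state \<omega> T"
    by (rule point_state_eqI[OF U]) (use tendsto_mult_left[OF lim[of T], of c] in simp)
  show "0 \<le> point_state \<omega> T" if "positive_op T"
    using Lim_in_closed_set[OF closed_nonneg_complex _ _ lim[of T]] that U
    by (simp add: positive_op_def entry_eq_cinner ultrafilter_def)
next
  show "point_state \<omega> 1 = 1" by (rule point_state_eqI[OF U]) simp
qed

lemma state_diff: "state \<phi> \<Longrightarrow> \<phi> (S - T) = \<phi> S - \<phi> T"
  unfolding state_def by (metis add_diff_cancel_right' diff_add_cancel)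

lemma state_scaleR: "state \<phi> \<Longrightarrow> \<phi> (r *\<^sub>R T) = complex_of_real r * \<phi> T"
  by (simp add: state_def scaleR_scaleC)

lemma state_mono:
  assumes "state \<phi>" "S \<le> T"
  shows "\<phi> S \<le> \<phi> T"
proof -
  have "0 \<le> \<phi> (T - S)" using assms by (simp add: state_def less_eq_bop_def)
  then show ?thesis by (simp add: state_diff[OF assms(1)])
qed

text \<open>The second extension that refutes uniqueness is a limit of vector states. Support in
  every set of \<omega> forces the right values on diagonal operators, while the failure of the
  lower bound fixes the value at \<open>H\<close>.\<close>

lemma supported_vector_state:
  assumes \<omega>: "ultrafilter \<omega>"
    and H: "\<And>A. \<forall>\<^sub>F n in \<omega>. n \<in> A \<Longrightarrow> \<not> below_on H c A"
  obtains \<phi> where "state \<phi>" "\<And>D. D \<in> diagonals \<Longrightarrow> \<phi> D = point_state \<omega> D" "Re (\<phi> H) \<le> c"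
proof -
  let ?\<A> = "{A. \<forall>\<^sub>F n in \<omega>. n \<in> A}"
  define V where "V A = {x. supported A x \<and> norm x = 1 \<and> inner (app H x) x \<le> c}" for A
  have V_ne: "V A \<noteq> {}" if A: "A \<in> ?\<A>" for A
  proof -
    obtain x where x: "supported A x" "inner (app H x) x < c * (norm x)\<^sup>2"
      using H[of A] A by (auto simp: below_on_def not_le)
    then have "norm x \<noteq> 0"
      using linear_0[OF bounded_linear.linear[OF bounded_linear_app]] by auto
    define y where "y = x /\<^sub>R norm x"
    have "inner (app H y) y = inner (app H x) x / (norm x)\<^sup>2"
      by (simp add: y_def linear_cmul[OF bounded_linear.linear[OF bounded_linear_app]]
          power2_eq_square divide_inverse)
    also have "\<dots> \<le> c" using x(2) \<open>norm x \<noteq> 0\<close> by (simp add: divide_le_eq)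
    finally have "inner (app H y) y \<le> c" .
    moreover have "supported A y" "norm y = 1"
      using x(1) \<open>norm x \<noteq> 0\<close> by (auto simp: y_def supported_def)
    ultimately show ?thesis by (auto simp: V_def)
  qed
  \<comment> \<open>The sets \<open>V A\<close> are nonempty and form a filter base, because
    \<open>V (A \<inter> B)\<close> lies in both \<open>V A\<close> and \<open>V B\<close>. An
    ultrafilter finer than \<open>F\<close> therefore concentrates on all of them at once.\<close>
  define F where "F = (INF A\<in>?\<A>. principal (V A))"
  have F_iff: "eventually P F \<longleftrightarrow> (\<exists>A\<in>?\<A>. eventually P (principal (V A)))" for P
    unfolding F_def
  proof (rule eventually_INF_base)
    show "?\<A> \<noteq> {}" by (auto intro!: exI[of _ UNIV])
    fix A B assume AB: "A \<in> ?\<A>" "B \<in> ?\<A>"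
    then have "A \<inter> B \<in> ?\<A>" by (simp add: eventually_conj)
    moreover have "V (A \<inter> B) \<subseteq> V A \<inter> V B" by (auto simp: V_def elim: supported_mono)
    ultimately show "\<exists>x\<in>?\<A>. principal (V x) \<le> inf (principal (V A)) (principal (V B))"
      by (intro bexI[of _ "A \<inter> B"]) auto
  qed
  have "F \<noteq> bot"
  proof
    assume "F = bot"
    then obtain A where "A \<in> ?\<A>" "eventually (\<lambda>_. False) (principal (V A))"
      using F_iff[of "\<lambda>_. False"] by auto
    then show False using V_ne[of A] by (auto simp: eventually_principal)
  qed
  then obtain U where U: "ultrafilter U" "U \<le> F" using ultrafilter_exists by blast
  have ev: "\<forall>\<^sub>F x in U. x \<in> V A" if "A \<in> ?\<A>" for A
    using order_trans[OF U(2)[unfolded F_def] INF_lower[OF that]] by (simp add: le_principal)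
  have "\<forall>\<^sub>F x in U. norm x = 1" using ev[of UNIV] by (auto simp: V_def elim: eventually_mono)
  then obtain \<phi> where \<phi>: "state \<phi>" "\<And>T. ((\<lambda>x. cinner (app T x) x) \<longlongrightarrow> \<phi> T) U"
    using vector_state_limit[OF U(1)] by blast
  have ne: "U \<noteq> bot" using U(1) by (simp add: ultrafilter_def)
  show thesis
  proof
    show "state \<phi>" by fact
    have "\<forall>\<^sub>F x in U. Re (cinner (app H x) x) \<le> c"
      using ev[of UNIV] by (auto simp: V_def inner_ell2_def elim: eventually_mono)
    then show "Re (\<phi> H) \<le> c"
      using tendsto_upperbound[OF tendsto_Re[OF \<phi>(2)[of H]]] ne by blast
    fix D assume D: "D \<in> diagonals"
    define d where "d = point_state \<omega> D"
    have "((\<lambda>x. cinner (app D x) x) \<longlongrightarrow> d) U"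
    proof (rule tendstoI)
      fix e :: real assume e: "e > 0"
      have "\<forall>\<^sub>F n in \<omega>. dist (entry D n n) d < e / 2"
        unfolding d_def by (rule tendstoD[OF point_state_tendsto[OF \<omega>]]) (use e in simp)
      \<comment> \<open>On vectors supported in this set, \<open>D\<close> differs from the scalar
        \<open>d\<close> by at most \<open>e / 2\<close>, coordinate by coordinate.\<close>
      then have A: "{n. dist (entry D n n) d < e / 2} \<in> ?\<A>" by simp
      show "\<forall>\<^sub>F x in U. dist (cinner (app D x) x) d < e"
        using ev[OF A]
      proof eventually_elim
        case (elim x)
        then have x: "norm x = 1" "\<And>n. e / 2 \<le> dist (entry D n n) d \<Longrightarrow> coord x n = 0"
          by (auto simp: V_def supported_def not_less)
        have "norm (app D x - d *\<^sub>C x) \<le> (e / 2) * norm x"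
        proof (rule norm_le_coord)
          fix n
          have "coord (app D x) n = entry D n n * coord x n"
            using coord_cond_exp[of D x n] by (simp add: diagonals_cond_exp[OF D])
          then have eq: "coord (app D x - d *\<^sub>C x) n = (entry D n n - d) * coord x n"
            by (simp add: algebra_simps)
          show "cmod (coord (app D x - d *\<^sub>C x) n) \<le> e / 2 * cmod (coord x n)"
          proof (cases "e / 2 \<le> dist (entry D n n) d")
            case False
            then show ?thesis unfolding eq norm_mult
              by (intro mult_right_mono) (simp_all add: dist_norm)
          qed (use eq x(2) in simp)
        qed (use e in simp)
        moreover have "cinner (app D x) x - d = cinner (app D x - d *\<^sub>C x) x"
          using x(1) by (simp add: cinner_diff_left cinner_scaleC_left cinner_self_norm)
        ultimately show ?case
          using cmod_cinner_le[of "app D x - d *\<^sub>C x" x] x(1) e by (simp add: dist_norm)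
      qed
    qed
    then show "\<phi> D = point_state \<omega> D" using \<phi>(2)[of D] tendsto_unique[OF ne] d_def by blast
  qed
qed

text \<open>If no set of \<omega> is good for \<open>H\<close>, there is an extension with real part
  at most \<open>- \<epsilon>\<close> at \<open>H\<close>, whereas \<open>point_state\<close> gives
  0 there because the diagonal of \<open>H\<close> vanishes.\<close>

lemma kadison_singer_imp_pavable:
  assumes kadison_singer
  shows pavable
  unfolding pavable_def
proof (intro allI impI)
  fix H and \<epsilon> :: real assume H: "adj H = H" "cond_exp H = 0" "\<epsilon> > 0"
  show "finitely_covers (below_on H (- \<epsilon>))"
    unfolding finitely_covers_iff_ultrafilter
  proof (intro allI impI, rule ccontr)
    fix \<omega> :: "nat filter"
    assume \<omega>: "ultrafilter \<omega>" and "\<nexists>A. below_on H (- \<epsilon>) A \<and> (\<forall>\<^sub>F n in \<omega>. n \<in> A)"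
    then obtain \<phi> where \<phi>: "state \<phi>" "\<And>D. D \<in> diagonals \<Longrightarrow> \<phi> D = point_state \<omega> D" "Re (\<phi> H) \<le> - \<epsilon>"
      using supported_vector_state[OF \<omega>, of H "- \<epsilon>"] by metis
    have "\<exists>!\<psi>. state \<psi> \<and> (\<forall>D\<in>diagonals. \<psi> D = point_state \<omega> D)"
      using assms \<omega> by (simp add: kadison_singer_def topspace_beta_nat)
    then have "\<phi> = point_state \<omega>" using \<phi> state_point_state[OF \<omega>] by blast
    moreover have "point_state \<omega> H = 0"
      using H(2) by (intro point_state_eqI[OF \<omega>]) (simp add: cond_exp_eq_0_iff)
    ultimately show False using \<phi>(3) H(3) by simp
  qed
qed

text \<open>The off-diagonal part \<open>2 Re (H u, v)\<close> is absorbed by \<open>2 M u v \<le> \<epsilon> u\<^sup>2 + M\<^sup>2 v\<^sup>2 / \<epsilon>\<close>.\<close>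

lemma below_on_imp_global_bound:
  assumes H: "adj H = H" and b: "below_on H (- \<epsilon>) A" and e: "\<epsilon> > 0"
  obtains C where "- H \<le> (2 * \<epsilon>) *\<^sub>R diag_proj A + C *\<^sub>R diag_proj (- A)"
proof -
  define M where "M = norm H"
  define C where "C = M\<^sup>2 / \<epsilon> + M"
  have "inner (app (- H) x) x
    \<le> inner (app ((2 * \<epsilon>) *\<^sub>R diag_proj A + C *\<^sub>R diag_proj (- A)) x) x" for x
  proof -
    define u v where "u = app (diag_proj A) x" and "v = app (diag_proj (- A)) x"
    have x: "x = u + v" by (simp add: u_def v_def diag_proj_compl)
    interpret bounded_linear "app H" by (rule bounded_linear_app)
    have "inner (app H v) u = inner (app H u) v"
      using H by (metis cinner_adj inner_commute inner_ell2_def)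
    then have "inner (app H x) x = inner (app H u) u + 2 * inner (app H u) v + inner (app H v) v"
      by (simp add: x add inner_add_left inner_add_right)
    moreover have "- \<epsilon> * (norm u)\<^sup>2 \<le> inner (app H u) u"
      using b by (simp add: below_on_def u_def)
    moreover have "- inner (app H v) v \<le> M * (norm v)\<^sup>2"
      using abs_inner_app_le[of H v] by (simp add: M_def)
    moreover have "- 2 * inner (app H u) v \<le> \<epsilon> * (norm u)\<^sup>2 + M\<^sup>2 / \<epsilon> * (norm v)\<^sup>2"
    proof -
      have "- inner (app H u) v \<le> norm (app H u) * norm v"
        using Cauchy_Schwarz_ineq2[of "app H u" v] by linarith
      also have "\<dots> \<le> M * norm u * norm v"
        unfolding M_def by (intro mult_right_mono app_norm_le) simp
      finally have "- 2 * inner (app H u) v \<le> 2 * (M * norm u * norm v)" by simp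
      moreover have "0 \<le> (\<epsilon> * norm u - M * norm v)\<^sup>2 / \<epsilon>" using e by simp
      then have "2 * (M * norm u * norm v) \<le> \<epsilon> * (norm u)\<^sup>2 + M\<^sup>2 / \<epsilon> * (norm v)\<^sup>2"
        using e by (simp add: field_simps power2_eq_square)
      ultimately show ?thesis by linarith
    qed
    ultimately have "- inner (app H x) x \<le> 2 * \<epsilon> * (norm u)\<^sup>2 + C * (norm v)\<^sup>2"
      by (simp add: C_def algebra_simps)
    then show ?thesis
      by (simp add: inner_add_left inner_diag_proj[of _ x x] power2_norm_eq_inner u_def v_def)
  qed
  then have "- H \<le> (2 * \<epsilon>) *\<^sub>R diag_proj A + C *\<^sub>R diag_proj (- A)"
    using H by (subst le_bop_iff) (simp_all add: adj_add adj_scaleR adj_minus del: app_simps)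
  then show thesis by (rule that)
qed

text \<open>An extension is determined by its values on self-adjoint operators with zero diagonal,
  and paving squeezes those values between arbitrarily small bounds.\<close>

lemma state_extension_unique:
  assumes pavable and \<omega>: "ultrafilter \<omega>" and \<phi>: "state \<phi>"
    and ext: "\<And>D. D \<in> diagonals \<Longrightarrow> \<phi> D = point_state \<omega> D"
  shows "\<phi> = point_state \<omega>"
proof -
  have proj: "\<phi> (diag_proj A) = z" if "\<forall>\<^sub>F n in \<omega>. entry (diag_proj A) n n = z" for A z
  proof -
    have "\<phi> (diag_proj A) = point_state \<omega> (diag_proj A)"
      by (rule ext) (simp add: diagonals_def entry_diag_proj)
    also have "\<dots> = z" by (rule point_state_eqI[OF \<omega> tendsto_eventually[OF that]])
    finally show ?thesis .
  qed
  have minus: "\<phi> (- T) = - \<phi> T" for T using state_scaleR[OF \<phi>, of "- 1" T] by simp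
  have le: "- \<phi> H \<le> complex_of_real (2 * \<epsilon>)" if H: "adj H = H" "cond_exp H = 0" and e: "\<epsilon> > 0" for H \<epsilon>
  proof -
    have "finitely_covers (below_on H (- \<epsilon>))" using assms(1) H e by (simp add: pavable_def)
    then obtain A where A: "below_on H (- \<epsilon>) A" "\<forall>\<^sub>F n in \<omega>. n \<in> A"
      using \<omega> unfolding finitely_covers_iff_ultrafilter by blast
    \<comment> \<open>Since \<phi> has no mass on the complement of \<open>A\<close>, the constant
      \<open>C\<close> below disappears however large it is.\<close>
    have P: "\<phi> (diag_proj A) = 1" "\<phi> (diag_proj (- A)) = 0"
      by (rule proj, rule eventually_mono[OF A(2)], simp add: entry_diag_proj)+
    obtain C where C: "- H \<le> (2 * \<epsilon>) *\<^sub>R diag_proj A + C *\<^sub>R diag_proj (- A)"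
      using below_on_imp_global_bound[OF H(1) A(1) e] by blast
    have "\<phi> ((2 * \<epsilon>) *\<^sub>R diag_proj A + C *\<^sub>R diag_proj (- A))
        = \<phi> ((2 * \<epsilon>) *\<^sub>R diag_proj A) + \<phi> (C *\<^sub>R diag_proj (- A))"
      using \<phi> unfolding state_def by blast
    also have "\<dots> = complex_of_real (2 * \<epsilon>)" by (simp add: state_scaleR[OF \<phi>] P)
    finally show ?thesis using state_mono[OF \<phi> C] by (simp add: minus)
  qed
  have zero: "\<phi> H = 0" if H: "adj H = H" "cond_exp H = 0" for H
  proof -
    have H': "adj (- H) = - H" "cond_exp (- H) = 0"
      using H by (simp_all add: adj_minus cond_exp_eq_0_iff)
    have b: "- Re (\<phi> H) \<le> 2 * \<epsilon>" "Re (\<phi> H) \<le> 2 * \<epsilon>" "Im (\<phi> H) = 0" if "\<epsilon> > 0" for \<epsilon>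
      using le[OF H that] le[OF H' that] by (simp_all add: less_eq_complex_def minus)
    have "\<bar>Re (\<phi> H)\<bar> \<le> 0 + e" if "e > 0" for e
      using b[of "e / 2"] that by auto
    then have "Re (\<phi> H) = 0" using field_le_epsilon[of "\<bar>Re (\<phi> H)\<bar>" 0] by simp
    then show ?thesis using b(3)[of 1] by (simp add: complex_eq_iff)
  qed
  show ?thesis
  proof
    fix T
    \<comment> \<open>Cartesian decomposition of the off-diagonal part: \<open>H\<close> and
      \<open>K\<close> are twice its real part and minus twice its imaginary part, both with zero
      diagonal.\<close>
    define R where "R = T - cond_exp T"
    define H K where "H = R + adj R" and "K = \<i> *\<^sub>C (R - adj R)"
    have R0: "entry R n n = 0" for n by (simp add: R_def entry_cond_exp)
    have "\<phi> H = 0"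
      by (rule zero) (simp_all add: H_def adj_add adj_adj cond_exp_eq_0_iff entry_adj R0 add.commute)
    moreover have "\<phi> K = 0"
    proof (rule zero)
      show "adj K = K"
        by (rule bop_eq_entry) (simp add: K_def entry_adj algebra_simps)
    qed (simp add: K_def cond_exp_eq_0_iff entry_adj R0)
    moreover have "R = (1/2) *\<^sub>C H + (- \<i>/2) *\<^sub>C K"
      by (rule bop_eq_entry) (simp add: H_def K_def field_simps)
    moreover have "\<phi> ((1/2) *\<^sub>C H + (- \<i>/2) *\<^sub>C K) = (1/2) * \<phi> H + (- \<i>/2) * \<phi> K"
      using \<phi> unfolding state_def by metis
    ultimately have "\<phi> R = 0" by simp
    then have "\<phi> T = \<phi> (cond_exp T)" using state_diff[OF \<phi>] by (simp add: R_def)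
    also have "\<dots> = point_state \<omega> (cond_exp T)" using ext cond_exp_in_diagonals by blast
    also have "\<dots> = point_state \<omega> T" by (simp add: point_state_def entry_cond_exp)
    finally show "\<phi> T = point_state \<omega> T" .
  qed
qed

lemma kadison_singer_iff_pavable: "kadison_singer \<longleftrightarrow> pavable"
proof
  assume pavable
  show kadison_singer
    unfolding kadison_singer_def
  proof
    fix \<omega> assume "\<omega> \<in> topspace beta_nat"
    then have \<omega>: "ultrafilter \<omega>" by (simp add: topspace_beta_nat)
    show "\<exists>!\<phi>. state \<phi> \<and> (\<forall>D\<in>diagonals. \<phi> D = point_state \<omega> D)"
    proof (rule ex1I)
      show "state (point_state \<omega>) \<and> (\<forall>D\<in>diagonals. point_state \<omega> D = point_state \<omega> D)"
        using state_point_state[OF \<omega>] by simp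
    qed (use state_extension_unique[OF \<open>pavable\<close> \<omega>] in blast)
  qed
qed (rule kadison_singer_imp_pavable)

section \<open>Paving an operator together with its inverse\<close>

text \<open>Completeness feeds the Banach fixed point theorem, by which operators in an order
  interval are inverted. The limit is taken coordinatewise.\<close>

instance ell2 :: complete_space
proof
  fix X :: "nat \<Rightarrow> ell2" assume X: "Cauchy X"
  have "Cauchy (\<lambda>k. coord (X k) n)" for n
  proof (rule metric_CauchyI)
    fix e :: real assume "e > 0"
    then obtain N where "\<And>k l. k \<ge> N \<Longrightarrow> l \<ge> N \<Longrightarrow> dist (X k) (X l) < e"
      using X unfolding Cauchy_def by metis
    moreover have "dist (coord (X k) n) (coord (X l) n) \<le> dist (X k) (X l)" for k l
      using cmod_coord_le[of "X k - X l" n] by (simp add: dist_norm)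
    ultimately show "\<exists>N. \<forall>k\<ge>N. \<forall>l\<ge>N. dist (coord (X k) n) (coord (X l) n) < e"
      by (meson order_le_less_trans)
  qed
  then have "\<exists>z. (\<lambda>k. coord (X k) n) \<longlonglongrightarrow> z" for n
    using Cauchy_convergent_iff convergent_def by blast
  then obtain a where a: "(\<lambda>k. coord (X k) n) \<longlonglongrightarrow> a n" for n by metis
  \<comment> \<open>The Cauchy estimate is passed to the limit in finite partial sums, where
    coordinatewise convergence suffices; the bound is uniform in \<open>L\<close>.\<close>
  have bound: "(\<Sum>n<L. (cmod (coord (X k) n - a n))\<^sup>2) \<le> e\<^sup>2"
    if "\<And>l. l \<ge> N \<Longrightarrow> dist (X k) (X l) < e" for k N L e
  proof (rule tendsto_upperbound)
    show "(\<lambda>l. \<Sum>n<L. (cmod (coord (X k) n - coord (X l) n))\<^sup>2)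
        \<longlonglongrightarrow> (\<Sum>n<L. (cmod (coord (X k) n - a n))\<^sup>2)"
      by (intro tendsto_intros a)
    have "(\<Sum>n<L. (cmod (coord (X k) n - coord (X l) n))\<^sup>2) \<le> e\<^sup>2" if "l \<ge> N" for l
    proof -
      have "(\<Sum>n<L. (cmod (coord (X k - X l) n))\<^sup>2) \<le> (norm (X k - X l))\<^sup>2"
        unfolding norm_sq_ell2 by (rule sum_le_suminf[OF coord_summable]) auto
      also have "\<dots> \<le> e\<^sup>2"
        using \<open>\<And>l. l \<ge> N \<Longrightarrow> dist (X k) (X l) < e\<close>[OF that] by (intro power_mono) (auto simp: dist_norm)
      finally show ?thesis by simp
    qed
    then show "\<forall>\<^sub>F l in sequentially. (\<Sum>n<L. (cmod (coord (X k) n - coord (X l) n))\<^sup>2) \<le> e\<^sup>2"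
      by (auto simp: eventually_sequentially)
  qed simp
  have tail: "\<exists>N. \<forall>k\<ge>N. summable (\<lambda>n. (cmod (coord (X k) n - a n))\<^sup>2)
      \<and> (\<Sum>n. (cmod (coord (X k) n - a n))\<^sup>2) \<le> e\<^sup>2" if e: "e > 0" for e
  proof -
    obtain N where N: "\<And>k l. k \<ge> N \<Longrightarrow> l \<ge> N \<Longrightarrow> dist (X k) (X l) < e"
      using X e unfolding Cauchy_def by metis
    have "summable (\<lambda>n. (cmod (coord (X k) n - a n))\<^sup>2)
      \<and> (\<Sum>n. (cmod (coord (X k) n - a n))\<^sup>2) \<le> e\<^sup>2" if "k \<ge> N" for k
    proof
      show s: "summable (\<lambda>n. (cmod (coord (X k) n - a n))\<^sup>2)"
        by (rule summableI_nonneg_bounded[OF _ bound[of N k e]]) (use N[OF that] in auto)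
      show "(\<Sum>n. (cmod (coord (X k) n - a n))\<^sup>2) \<le> e\<^sup>2"
        by (rule suminf_le_const[OF s bound[of N k e]]) (use N[OF that] in auto)
    qed
    then show ?thesis by blast
  qed
  obtain N where "summable (\<lambda>n. (cmod (coord (X N) n - a n))\<^sup>2)" using tail[of 1] by auto
  \<comment> \<open>The limit sequence is \<open>X N\<close> minus a square-summable difference,
    hence itself a vector.\<close>
  then have "summable (\<lambda>n. (cmod (coord (X N) n + - (coord (X N) n - a n)))\<^sup>2)"
    by (intro summable_sq_add coord_summable) (simp only: norm_minus_cancel)
  then have ca: "coord (Abs_ell2 a) = a" by (simp add: Abs_ell2_inverse)
  have "X \<longlonglongrightarrow> Abs_ell2 a"
  proof (rule metric_LIMSEQ_I)
    fix e :: real assume "e > 0"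
    then obtain N where N: "\<And>k. k \<ge> N \<Longrightarrow> (norm (X k - Abs_ell2 a))\<^sup>2 \<le> (e / 2)\<^sup>2"
      using tail[of "e / 2"] by (auto simp: norm_sq_ell2 ca)
    have "norm (X k - Abs_ell2 a) \<le> e / 2" if "k \<ge> N" for k
      by (rule power2_le_imp_le[OF N[OF that]]) (use \<open>e > 0\<close> in simp)
    then show "\<exists>N. \<forall>k\<ge>N. dist (X k) (Abs_ell2 a) < e"
      using \<open>e > 0\<close> by (intro exI[of _ N]) (force simp: dist_norm)
  qed
  then show "convergent X" by (auto simp: convergent_def)
qed

section \<open>Inverses and order intervals\<close>

lemma bop_of_function:
  assumes add: "\<And>x y. f (x + y) = f x + f y" and scaleC: "\<And>c x. f (c *\<^sub>C x) = c *\<^sub>C f x"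
    and bound: "\<And>x. norm (f x) \<le> K * norm x"
  obtains T where "\<And>x. app T x = f x"
proof -
  have bl: "bounded_linear f"
    by (rule bounded_linear_intro[of _ K])
      (simp_all add: add scaleR_scaleC scaleC bound mult.commute[of _ K])
  have "app (Abs_bop (Blinfun f)) x = f x" for x
    by (simp add: app.rep_eq Abs_bop_inverse bounded_linear_Blinfun_apply[OF bl] scaleC)
  then show thesis by (rule that)
qed

lemma op_inverse_eqI:
  assumes "S * T = 1" "T * S = 1"
  shows "op_invertible T" "op_inverse T = S"
proof -
  show inv: "op_invertible T" using assms by (auto simp: op_invertible_def)
  show "op_inverse T = S" using op_inverse[OF inv] assms by (metis mult.assoc mult_1_left mult_1_right)
qed

lemma app_op_inverse:
  assumes "op_invertible T"
  shows "app T (app (op_inverse T) x) = x" "app (op_inverse T) (app T x) = x"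
  using op_inverse[OF assms] by (metis app_simps(7,8))+

lemma op_inverse_self_adj:
  assumes "op_invertible P" "adj P = P"
  shows "adj (op_inverse P) = op_inverse P"
  unfolding self_adj_iff
proof (intro allI)
  fix x y
  let ?Q = "app (op_inverse P)"
  have "cinner (?Q x) (app P (?Q y)) = cinner (app P (?Q x)) (?Q y)"
    using assms(2) cinner_adj[of P] by metis
  then show "cinner (?Q x) y = cinner x (?Q y)" by (simp add: app_op_inverse[OF assms(1)])
qed

lemma op_interval_iff:
  assumes "0 \<le> a"
  shows "P \<in> op_interval a b \<longleftrightarrow>
    adj P = P \<and> (\<forall>x. a * (norm x)\<^sup>2 \<le> inner (app P x) x \<and> inner (app P x) x \<le> b * (norm x)\<^sup>2)"
proof (cases "adj P = P")
  case True
  have "(\<forall>x. 0 \<le> inner (app P x) x)" if "\<forall>x. a * (norm x)\<^sup>2 \<le> inner (app P x) x"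
    using that assms by (meson mult_nonneg_nonneg order_trans zero_le_power2)
  then show ?thesis
    using True by (auto simp: op_interval_def positive_op_iff le_bop_iff adj_scaleR power2_norm_eq_inner)
next
  case False
  then show ?thesis by (auto simp: op_interval_def positive_op_iff dest: nonneg_imp_self_adj)
qed

lemma op_interval_bounds:
  assumes "0 < a" "P \<in> op_interval a b"
  shows "a \<le> b"
proof -
  have "a * (norm (basis_vec 0))\<^sup>2 \<le> b * (norm (basis_vec 0))\<^sup>2"
    using assms op_interval_iff[of a P b] by (meson less_imp_le order_trans)
  then show ?thesis by simp
qed

text \<open>Solving \<open>app P x = y\<close> is the fixed point equation of the map sending
  \<open>x\<close> to \<open>app K x + y /\<^sub>R b\<close>, a contraction because the spectrum of
  \<open>P / b\<close> lies in \<open>[a / b, 1]\<close>. The lower bound on \<open>P\<close> gives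
  injectivity and the norm estimate.\<close>

lemma op_interval_invertible:
  assumes a: "0 < a" and P: "P \<in> op_interval a b"
  shows "op_invertible P" "norm (op_inverse P) \<le> 1 / a"
proof -
  have b: "0 < b" "a \<le> b" using op_interval_bounds[OF assms] a by auto
  have sa: "adj P = P" and lo: "\<And>x. a * (norm x)\<^sup>2 \<le> inner (app P x) x"
    and up: "\<And>x. inner (app P x) x \<le> b * (norm x)\<^sup>2"
    using P a by (auto simp: op_interval_iff)
  define K where "K = 1 - (1 / b) *\<^sub>R P"
  have nK: "norm K \<le> 1 - a / b"
  proof (rule self_adj_norm_le)
    fix x
    have "inner (app K x) x = (norm x)\<^sup>2 - inner (app P x) x / b"
      by (simp add: K_def inner_diff_left power2_norm_eq_inner)
    moreover have "inner (app P x) x / b \<le> (norm x)\<^sup>2"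
      using up[of x] b by (simp add: divide_le_eq mult.commute)
    moreover have "a / b * (norm x)\<^sup>2 \<le> inner (app P x) x / b"
      using lo[of x] b by (simp add: divide_right_mono)
    ultimately show "\<bar>inner (app K x) x\<bar> \<le> (1 - a / b) * (norm x)\<^sup>2"
      by (simp add: algebra_simps)
  qed (use sa b in \<open>simp_all add: K_def adj_diff adj_scaleR\<close>)
  have "\<exists>x. app P x = y" for y
  proof -
    have "\<exists>!x. app K x + y /\<^sub>R b = x"
    proof (rule banach_fix_type)
      show "0 \<le> 1 - a / b" "1 - a / b < 1" using a b by auto
      show "\<forall>u v. dist (app K u + y /\<^sub>R b) (app K v + y /\<^sub>R b) \<le> (1 - a / b) * dist u v"
      proof (intro allI)
        fix u v
        have "dist (app K u + y /\<^sub>R b) (app K v + y /\<^sub>R b) = norm (app K (u - v))"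
          by (simp add: dist_norm linear_diff[OF bounded_linear.linear[OF bounded_linear_app]])
        also have "\<dots> \<le> norm K * norm (u - v)" by (rule app_norm_le)
        also have "\<dots> \<le> (1 - a / b) * dist u v"
          unfolding dist_norm by (rule mult_right_mono[OF nK]) simp
        finally show "dist (app K u + y /\<^sub>R b) (app K v + y /\<^sub>R b) \<le> (1 - a / b) * dist u v" .
      qed
    qed
    then obtain x where "app K x + y /\<^sub>R b = x" by blast
    then have "(1 / b) *\<^sub>R app P x = (1 / b) *\<^sub>R y"
      by (auto simp: K_def inverse_eq_divide algebra_simps)
    then have "app P x = y" using b by (metis less_irrefl scaleR_left_imp_eq zero_less_divide_1_iff)
    then show ?thesis ..
  qed
  then obtain g where g: "\<And>y. app P (g y) = y" by metis
  have low: "norm x \<le> 1 / a * norm (app P x)" for x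
  proof -
    have "a * norm x * norm x \<le> norm (app P x) * norm x"
      using order_trans[OF lo norm_cauchy_schwarz, of x] by (simp add: power2_eq_square mult.assoc)
    then have "a * norm x \<le> norm (app P x)" by (cases "x = 0") auto
    then show ?thesis using a by (simp add: field_simps)
  qed
  have inj: "x = y" if "app P x = app P y" for x y
    using low[of "x - y"] that
    by (simp add: linear_diff[OF bounded_linear.linear[OF bounded_linear_app]])
  obtain Q where Q: "\<And>x. app Q x = g x"
  proof (rule bop_of_function[of g "1 / a"])
    show "g (x + y) = g x + g y" for x y
      by (rule inj) (simp add: g linear_add[OF bounded_linear.linear[OF bounded_linear_app]])
    show "g (c *\<^sub>C x) = c *\<^sub>C g x" for c x by (rule inj) (simp add: g app_scaleC)
    show "norm (g x) \<le> 1 / a * norm x" for x using low[of "g x"] by (simp add: g)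
  qed blast
  have "Q * P = 1" "P * Q = 1" by (rule bop_eqI, simp add: Q g inj)+
  then have inv: "op_invertible P" "op_inverse P = Q" by (rule op_inverse_eqI)+
  then show "op_invertible P" by simp
  show "norm (op_inverse P) \<le> 1 / a"
    unfolding inv(2) by (rule norm_bop_le) (use low[of "g x" for x] a in \<open>simp_all add: Q g\<close>)
qed

section \<open>Joint lower bounds for an operator and its inverse on one block\<close>

definition inverse_paved :: "bop \<Rightarrow> real \<Rightarrow> nat set \<Rightarrow> bool" where
  "inverse_paved P \<epsilon> A \<longleftrightarrow> (\<exists>c d. c > 0 \<and> d > 0 \<and> c * d > 1 - \<epsilon> \<and>
    below_on P c A \<and> below_on (op_inverse P) d A)"

lemma inverse_paved_mono: "inverse_paved P \<epsilon> A \<Longrightarrow> B \<subseteq> A \<Longrightarrow> inverse_paved P \<epsilon> B"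
  unfolding inverse_paved_def by (meson below_on_mono)

lemma below_on_empty [simp]: "below_on X c {}"
proof -
  have "x = 0" if "supported {} x" for x
    by (rule ell2_eqI) (use that in \<open>simp add: supported_def\<close>)
  moreover have "app X 0 = 0" by (rule linear_0[OF bounded_linear.linear[OF bounded_linear_app]])
  ultimately show ?thesis unfolding below_on_def by fastforce
qed

text \<open>Empty sets may occur in a paving; there both bounds are vacuous and c = d = 1 is a valid
  choice.\<close>

lemma inverse_paved_empty: "\<epsilon> > 0 \<Longrightarrow> inverse_paved P \<epsilon> {}"
  by (auto simp: inverse_paved_def intro!: exI[of _ 1])

lemma below_on_basis_vec: "below_on X c A \<Longrightarrow> n \<in> A \<Longrightarrow> c \<le> Re (entry X n n)"
  unfolding below_on_def
  by (drule spec[of _ "basis_vec n"])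
    (auto simp: supported_def coord_basis_vec entry_eq_cinner inner_ell2_def)

lemma below_on_cond_exp:
  assumes "\<And>n. n \<in> A \<Longrightarrow> u \<le> Re (entry T n n)"
  shows "below_on (cond_exp T) u A"
  unfolding below_on_def
proof (intro allI impI)
  fix x assume x: "supported A x"
  have "inner (app (cond_exp T) x) x = (\<Sum>n. Re (coord (app (cond_exp T) x) n * cnj (coord x n)))"
    by (simp add: inner_ell2_def cinner_def Re_suminf[OF cinner_summable])
  also have "\<dots> \<ge> (\<Sum>n. u * (cmod (coord x n))\<^sup>2)"
  proof (rule suminf_le)
    fix n
    have "coord (app (cond_exp T) x) n * cnj (coord x n)
        = entry T n n * complex_of_real ((cmod (coord x n))\<^sup>2)"
      unfolding coord_cond_exp complex_norm_square by simp
    then have "Re (coord (app (cond_exp T) x) n * cnj (coord x n)) = Re (entry T n n) * (cmod (coord x n))\<^sup>2"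
      by simp
    then show "u * (cmod (coord x n))\<^sup>2 \<le> Re (coord (app (cond_exp T) x) n * cnj (coord x n))"
      using assms[of n] x by (cases "n \<in> A") (auto simp: supported_def intro: mult_right_mono)
  qed (intro summable_mult coord_summable summable_Re cinner_summable)+
  finally show "u * (norm x)\<^sup>2 \<le> inner (app (cond_exp T) x) x"
    by (simp add: norm_sq_ell2 suminf_mult[OF coord_summable])
qed

text \<open>A bounded sequence has a limit along every ultrafilter, and the window of width \<delta>
  centred there captures a set of that ultrafilter.\<close>

lemma finitely_covers_oscillation:
  fixes f :: "nat \<Rightarrow> real"
  assumes f: "\<And>n. \<bar>f n\<bar> \<le> M" and \<delta>: "\<delta> > 0"
  shows "finitely_covers (\<lambda>A. \<exists>u. \<forall>n\<in>A. u \<le> f n \<and> f n \<le> u + \<delta>)"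
  unfolding finitely_covers_iff_ultrafilter
proof (intro allI impI)
  fix \<omega> :: "nat filter" assume \<omega>: "ultrafilter \<omega>"
  obtain z where z: "(f \<longlongrightarrow> z) \<omega>"
  proof (rule ultrafilter_compact_tendsto[OF \<omega>])
    show "compact {-M..M}" by simp
    show "\<forall>\<^sub>F n in \<omega>. f n \<in> {-M..M}" using f by (intro always_eventually) (auto simp: abs_le_iff minus_le_iff)
  qed blast
  have "\<forall>n\<in>{n. dist (f n) z < \<delta> / 2}. z - \<delta> / 2 \<le> f n \<and> f n \<le> (z - \<delta> / 2) + \<delta>"
  proof
    fix n assume "n \<in> {n. dist (f n) z < \<delta> / 2}"
    then have "\<bar>f n - z\<bar> < \<delta> / 2" by (simp add: dist_real_def)
    then show "z - \<delta> / 2 \<le> f n \<and> f n \<le> (z - \<delta> / 2) + \<delta>" by linarith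
  qed
  moreover have "\<forall>\<^sub>F n in \<omega>. n \<in> {n. dist (f n) z < \<delta> / 2}"
    using tendstoD[OF z, of "\<delta> / 2"] \<delta> by simp
  ultimately show "\<exists>A. (\<exists>u. \<forall>n\<in>A. u \<le> f n \<and> f n \<le> u + \<delta>) \<and> (\<forall>\<^sub>F n in \<omega>. n \<in> A)" by blast
qed

text \<open>Cauchy-Schwarz for the positive form of \<open>P\<close>, applied to a basis vector
  \<open>e\<close> and the solution \<open>y\<close> of \<open>app P y = e\<close>: the form has
  values p and q at these vectors and 1 across them.\<close>

lemma entry_mult_op_inverse_ge_1:
  assumes "positive_op P" "op_invertible P"
  shows "0 \<le> Re (entry P n n)" "0 \<le> Re (entry (op_inverse P) n n)"
    "1 \<le> Re (entry P n n) * Re (entry (op_inverse P) n n)"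
proof -
  let ?e = "basis_vec n"
  define y where "y = app (op_inverse P) ?e"
  define p q where "p = Re (entry P n n)" and "q = Re (entry (op_inverse P) n n)"
  interpret bounded_linear "app P" by (rule bounded_linear_app)
  have sa: "adj P = P" using assms nonneg_imp_self_adj by (simp add: positive_op_iff)
  have pos: "0 \<le> inner (app P x) x" for x
    using assms by (simp add: positive_op_def inner_ell2_def less_eq_complex_def)
  have Py: "app P y = ?e" by (simp add: y_def app_op_inverse[OF assms(2)])
  have ey: "inner (app P ?e) y = 1"
  proof -
    have "inner (app P ?e) y = inner ?e (app P y)"
      using sa cinner_adj[of P] by (metis inner_ell2_def)
    then show ?thesis by (simp add: Py power2_norm_eq_inner[symmetric])
  qed
  have pe: "p = inner (app P ?e) ?e" by (simp add: p_def entry_eq_cinner inner_ell2_def)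
  have ye: "inner y (app P ?e) = 1" using ey by (simp add: inner_commute)
  have qe: "q = inner ?e y"
    by (simp add: q_def entry_eq_cinner inner_ell2_def y_def[symmetric]) (metis cinner_commute complex_cnj(1) complex.sel(1) complex_surj)
  \<comment> \<open>The form at \<open>e - t y\<close> is a nonnegative quadratic in
    \<open>t\<close>. The choice \<open>t = p + 1\<close> excludes q = 0, and the minimiser
    \<open>t = 1 / q\<close> yields the claim.\<close>
  have quad: "0 \<le> p - 2 * t + t\<^sup>2 * q" for t
  proof -
    have "inner (app P (?e - t *\<^sub>R y)) (?e - t *\<^sub>R y) = p - 2 * t + t\<^sup>2 * q"
      by (simp add: diff scaleR Py inner_diff_left inner_diff_right ey pe qe
          inner_commute[of "app P (basis_vec n)"] power2_norm_eq_inner[symmetric])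
        (simp add: inner_commute[of y "basis_vec n"] power2_eq_square ye algebra_simps)
    then show ?thesis using pos by metis
  qed
  show p0: "0 \<le> p" using quad[of 0] by simp
  show q0: "0 \<le> q" using pos[of y] by (simp add: Py qe)
  have "q \<noteq> 0"
  proof
    assume "q = 0"
    then show False using quad[of "p + 1"] p0 by simp
  qed
  then show "1 \<le> p * q" using quad[of "1 / q"] q0 by (simp add: field_simps power2_eq_square)
qed

text \<open>On a block where both off-diagonal parts are at least -\<delta> and both diagonals vary
  by at most \<delta>, the constants c and d can be taken within 2\<delta> of the diagonal entries
  at any index of the block, whose product is at least 1.\<close>

lemma pavable_imp_inverse_paved:
  assumes pav: pavable and P: "positive_op P" "op_invertible P" and \<epsilon>: "\<epsilon> > 0"
  shows "finitely_covers (inverse_paved P \<epsilon>)"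
proof -
  define Q where "Q = op_inverse P"
  define p q where "p n = Re (entry P n n)" and "q n = Re (entry Q n n)" for n
  have saP: "adj P = P" using P nonneg_imp_self_adj by (simp add: positive_op_iff)
  have saQ: "adj Q = Q" unfolding Q_def by (rule op_inverse_self_adj[OF P(2) saP])
  have pq: "0 \<le> p n" "0 \<le> q n" "1 \<le> p n * q n" for n
    using entry_mult_op_inverse_ge_1[OF P] by (auto simp: p_def q_def Q_def)
  \<comment> \<open>\<open>M\<close> bounds both diagonals above; as the product of corresponding
    entries is at least 1, both are also at least \<open>1 / M\<close>.\<close>
  define M where "M = 1 + norm P + norm Q"
  have M: "1 \<le> M" by (simp add: M_def)
  have le: "p n \<le> M" "q n \<le> M" for n
    using order_trans[OF complex_Re_le_cmod cmod_entry_le, of P n n]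
      order_trans[OF complex_Re_le_cmod cmod_entry_le, of Q n n] norm_ge_zero[of P] norm_ge_zero[of Q]
    unfolding p_def q_def M_def by linarith+
  have ge: "1 / M \<le> p n" "1 / M \<le> q n" for n
    using mult_left_mono[OF le(2)[of n] pq(1)[of n]] mult_right_mono[OF le(1)[of n] pq(2)[of n]] pq(3)[of n] M
    by (simp_all add: divide_le_eq mult.commute)
  \<comment> \<open>The first bound keeps the loss \<open>4 * \<delta> * M\<close> in the product
    below \<epsilon>; the second keeps both constants positive, since the entries are at least
    \<open>1 / M\<close>.\<close>
  define \<delta> where "\<delta> = min (\<epsilon> / (8 * M)) (1 / (4 * M))"
  have \<delta>: "\<delta> > 0" "4 * \<delta> * M < \<epsilon>" "2 * \<delta> < 1 / M"
  proof -
    show "\<delta> > 0" using \<epsilon> M by (simp add: \<delta>_def)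
    have "\<delta> \<le> \<epsilon> / (8 * M)" "\<delta> \<le> 1 / (4 * M)" by (simp_all add: \<delta>_def)
    then have "8 * \<delta> * M \<le> \<epsilon>" "4 * \<delta> * M \<le> 1" using M by (simp_all add: field_simps)
    then show "4 * \<delta> * M < \<epsilon>" "2 * \<delta> < 1 / M" using \<epsilon> M by (simp_all add: field_simps)
  qed
  have off: "finitely_covers (below_on (T - cond_exp T) (- \<delta>))" if "adj T = T" for T
  proof -
    have "adj (cond_exp T) = cond_exp T"
      using that by (intro bop_eq_entry) (metis complex_cnj_zero entry_adj entry_cond_exp)
    then have "adj (T - cond_exp T) = T - cond_exp T" using that by (simp add: adj_diff)
    moreover have "cond_exp (T - cond_exp T) = 0" by (simp add: cond_exp_eq_0_iff entry_cond_exp)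
    ultimately show ?thesis using pav \<delta>(1) unfolding pavable_def by blast
  qed
  let ?osc = "\<lambda>f A. \<exists>u. \<forall>n\<in>A. u \<le> f n \<and> f n \<le> u + \<delta>"
  have osc: "finitely_covers (?osc p)" "finitely_covers (?osc q)"
    by (rule finitely_covers_oscillation[of _ M]; use le pq \<delta> in \<open>simp add: abs_of_nonneg\<close>)+
  have "finitely_covers (\<lambda>A. (below_on (P - cond_exp P) (- \<delta>) A \<and> below_on (Q - cond_exp Q) (- \<delta>) A)
      \<and> (?osc p A \<and> ?osc q A))"
    by (intro finitely_covers_conj off osc saP saQ) (blast intro: below_on_mono)+
  then show ?thesis
  proof (rule finitely_covers_mono)
    fix A
    assume A: "(below_on (P - cond_exp P) (- \<delta>) A \<and> below_on (Q - cond_exp Q) (- \<delta>) A)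
      \<and> (?osc p A \<and> ?osc q A)"
    show "inverse_paved P \<epsilon> A"
    proof (cases "A = {}")
      case False
      then obtain n where n: "n \<in> A" by blast
      obtain u v where u: "\<And>n. n \<in> A \<Longrightarrow> u \<le> p n \<and> p n \<le> u + \<delta>"
        and v: "\<And>n. n \<in> A \<Longrightarrow> v \<le> q n \<and> q n \<le> v + \<delta>" using A by blast
      have bl: "below_on P (u - \<delta>) A" "below_on Q (v - \<delta>) A"
        using below_on_add[OF conjunct1[OF conjunct1[OF A]] below_on_cond_exp[of A u P]] u
          below_on_add[OF conjunct2[OF conjunct1[OF A]] below_on_cond_exp[of A v Q]] v
        by (auto simp: p_def q_def)
      have c: "u - \<delta> \<ge> p n - 2 * \<delta>" "v - \<delta> \<ge> q n - 2 * \<delta>" using u[OF n] v[OF n] by auto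
      have pos: "p n - 2 * \<delta> > 0" "q n - 2 * \<delta> > 0" using ge[of n] \<delta>(3) by auto
      have "1 - \<epsilon> < (p n - 2 * \<delta>) * (q n - 2 * \<delta>)"
      proof -
        have "(p n - 2 * \<delta>) * (q n - 2 * \<delta>) = p n * q n - 2 * \<delta> * (p n + q n) + 4 * \<delta>\<^sup>2"
          by (simp add: algebra_simps power2_eq_square)
        moreover have "2 * \<delta> * (p n + q n) \<le> 2 * \<delta> * (2 * M)"
          using le[of n] \<delta>(1) by (intro mult_left_mono) auto
        moreover have "0 \<le> 4 * \<delta>\<^sup>2" by simp
        ultimately show ?thesis using pq(3)[of n] \<delta>(2) by linarith
      qed
      also have "\<dots> \<le> (u - \<delta>) * (v - \<delta>)" using c pos by (intro mult_mono) auto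
      finally show ?thesis
        unfolding inverse_paved_def Q_def[symmetric] using bl c pos
        by (intro exI[of _ "u - \<delta>"] exI[of _ "v - \<delta>"]) auto
    qed (simp add: inverse_paved_empty \<epsilon>)
  qed
qed

text \<open>For \<open>P = 1 + t H\<close> the diagonal of \<open>P\<inverse> = 1 - t H + t\<^sup>2 P\<inverse> H\<^sup>2\<close> is \<open>1 + O(t\<^sup>2)\<close>, so \<open>d\<close> is at most
  \<open>1 + O(t\<^sup>2)\<close> and \<open>c\<close> is at least \<open>1 - O(t\<^sup>2)\<close>.\<close>

lemma inverse_paved_imp_pavable:
  fixes a b :: real
  assumes ab: "0 < a" "a < 1" "1 < b"
    and pav: "\<And>P \<epsilon>. P \<in> op_interval a b \<Longrightarrow> \<epsilon> > 0 \<Longrightarrow> finitely_covers (inverse_paved P \<epsilon>)"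
  shows pavable
  unfolding pavable_def
proof (intro allI impI)
  fix H and \<epsilon> :: real assume H: "adj H = H" "cond_exp H = 0" and \<epsilon>: "\<epsilon> > 0"
  define M where "M = norm H + 1"
  define K where "K = M\<^sup>2 / a"
  have M: "M > 0" by (simp add: M_def add_nonneg_pos)
  have K: "K \<ge> 0" using ab by (simp add: K_def)
  \<comment> \<open>The first two bounds place \<open>1 + t H\<close> in the interval [a, b]; the
    third makes the final error \<open>t * (1 + K)\<close> at most \<epsilon>. Here \<open>K\<close>
    bounds the norm of the remainder \<open>Q * (H * H)\<close>, through the bound
    \<open>1 / a\<close> on the inverse.\<close>
  define t where "t = min (min ((1 - a) / M) ((b - 1) / M)) (\<epsilon> / (1 + K))"
  have t: "t > 0" "t * M \<le> 1 - a" "t * M \<le> b - 1" "t * (1 + K) \<le> \<epsilon>"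
  proof -
    have "t \<le> (1 - a) / M" "t \<le> (b - 1) / M" "t \<le> \<epsilon> / (1 + K)" by (simp_all add: t_def)
    then show "t * M \<le> 1 - a" "t * M \<le> b - 1" "t * (1 + K) \<le> \<epsilon>"
      using M K by (simp_all add: pos_le_divide_eq)
    show "t > 0" using ab M K \<epsilon> by (simp add: t_def)
  qed
  define P where "P = 1 + t *\<^sub>R H"
  have P: "P \<in> op_interval a b"
  proof -
    have "a * (norm x)\<^sup>2 \<le> inner (app P x) x \<and> inner (app P x) x \<le> b * (norm x)\<^sup>2" for x
    proof -
      have "\<bar>inner (app H x) x\<bar> \<le> M * (norm x)\<^sup>2"
        using order_trans[OF abs_inner_app_le mult_right_mono[of "norm H" M]] by (simp add: M_def)
      then have "t * \<bar>inner (app H x) x\<bar> \<le> t * (M * (norm x)\<^sup>2)" using t(1) by (intro mult_left_mono) auto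
      then have "\<bar>t * inner (app H x) x\<bar> \<le> t * M * (norm x)\<^sup>2" using t(1) by (simp add: abs_mult mult.assoc)
      moreover have "t * M * (norm x)\<^sup>2 \<le> (1 - a) * (norm x)\<^sup>2" "t * M * (norm x)\<^sup>2 \<le> (b - 1) * (norm x)\<^sup>2"
        by (rule mult_right_mono[OF t(2)], simp) (rule mult_right_mono[OF t(3)], simp)
      moreover have "inner (app P x) x = (norm x)\<^sup>2 + t * inner (app H x) x"
        by (simp add: P_def inner_add_left power2_norm_eq_inner)
      ultimately show ?thesis unfolding abs_le_iff left_diff_distrib by linarith
    qed
    then show ?thesis using ab H by (simp add: op_interval_iff P_def adj_add adj_scaleR)
  qed
  define Q where "Q = op_inverse P"
  note inv = op_interval_invertible[OF ab(1) P, folded Q_def]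
  have Q_eq: "Q = 1 - t *\<^sub>R H + t\<^sup>2 *\<^sub>R (Q * (H * H))"
  proof -
    have "P * (1 - t *\<^sub>R H) = 1 - t\<^sup>2 *\<^sub>R (H * H)"
      by (simp add: P_def algebra_simps power2_eq_square)
    then have "Q * (P * (1 - t *\<^sub>R H)) = Q - t\<^sup>2 *\<^sub>R (Q * (H * H))"
      by (simp add: right_diff_distrib)
    moreover have "Q * (P * (1 - t *\<^sub>R H)) = 1 - t *\<^sub>R H"
      using op_inverse(1)[OF inv(1)] by (simp add: Q_def mult.assoc[symmetric])
    ultimately show ?thesis by simp
  qed
  have nQ: "norm (Q * (H * H)) \<le> K"
  proof -
    have "norm (Q * (H * H)) \<le> norm Q * norm (H * H)" by (rule norm_mult_ineq)
    also have "\<dots> \<le> 1 / a * (norm H * norm H)"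
      using inv(2) norm_mult_ineq[of H H] ab by (intro mult_mono) auto
    also have "\<dots> \<le> 1 / a * (M * M)"
      using ab by (intro mult_left_mono mult_mono) (auto simp: M_def)
    finally show ?thesis by (simp add: K_def power2_eq_square)
  qed
  have diagQ: "Re (entry Q n n) \<le> 1 + t\<^sup>2 * K" for n
  proof -
    have "entry Q n n = 1 + complex_of_real (t\<^sup>2) * entry (Q * (H * H)) n n"
      using H(2) by (subst Q_eq) (simp add: cond_exp_eq_0_iff)
    then have "Re (entry Q n n) = 1 + t\<^sup>2 * Re (entry (Q * (H * H)) n n)" by simp
    moreover have "Re (entry (Q * (H * H)) n n) \<le> K"
      using complex_Re_le_cmod cmod_entry_le nQ order_trans by meson
    ultimately show ?thesis by (simp add: mult_left_mono)
  qed
  \<comment> \<open>The tolerance is of second order in \<open>t\<close>, like the excess of the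
    diagonal of \<open>Q\<close> over 1, so the first-order term in \<open>H\<close> is not
    swamped.\<close>
  have "finitely_covers (inverse_paved P (t\<^sup>2))" using pav[OF P] t(1) by simp
  then show "finitely_covers (below_on H (- \<epsilon>))"
  proof (rule finitely_covers_mono)
    fix A assume "inverse_paved P (t\<^sup>2) A"
    then obtain c d where cd: "c > 0" "d > 0" "c * d > 1 - t\<^sup>2" "below_on P c A" "below_on Q d A"
      unfolding inverse_paved_def Q_def by blast
    show "below_on H (- \<epsilon>) A"
    proof (cases "A = {}")
      case False
      then obtain n where n: "n \<in> A" by blast
      have d: "d \<le> 1 + t\<^sup>2 * K" using below_on_basis_vec[OF cd(5) n] diagQ[of n] by simp
      have "1 - t\<^sup>2 * (1 + K) \<le> c"
      proof (rule ccontr)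
        assume "\<not> ?thesis"
        \<comment> \<open>A smaller \<open>c\<close> would contradict the paving: the expanded
          product falls short of \<open>1 - t\<^sup>2\<close> by the nonnegative term
          \<open>(t\<^sup>2 * (1 + K)) * (t\<^sup>2 * K)\<close>.\<close>
        then have "c * d \<le> (1 - t\<^sup>2 * (1 + K)) * (1 + t\<^sup>2 * K)"
          using cd d by (intro mult_mono) auto
        also have "\<dots> = 1 - t\<^sup>2 - (t\<^sup>2 * (1 + K)) * (t\<^sup>2 * K)" by (simp add: algebra_simps)
        also have "\<dots> \<le> 1 - t\<^sup>2" using K by simp
        finally show False using cd(3) by simp
      qed
      then have "below_on P (1 - t\<^sup>2 * (1 + K)) A" by (rule below_on_weaken[OF cd(4)])
      then have P_lower: "(1 - t\<^sup>2 * (1 + K)) * (norm x)\<^sup>2 \<le> inner (app P x) x" if "supported A x" for x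
        using that by (simp add: below_on_def)
      have "below_on H (- (t * (1 + K))) A"
        unfolding below_on_def
      proof (intro allI impI)
        fix x assume "supported A x"
        moreover have "inner (app P x) x = (norm x)\<^sup>2 + t * inner (app H x) x"
          by (simp add: P_def inner_add_left power2_norm_eq_inner)
        ultimately have "0 \<le> t * (t * (1 + K) * (norm x)\<^sup>2 + inner (app H x) x)"
          using P_lower[of x] by (simp add: algebra_simps power2_eq_square)
        then have "0 \<le> t * (1 + K) * (norm x)\<^sup>2 + inner (app H x) x"
          using t(1) by (simp add: zero_le_mult_iff)
        then show "- (t * (1 + K)) * (norm x)\<^sup>2 \<le> inner (app H x) x" by simp
      qed
      then show ?thesis by (rule below_on_weaken) (use t(4) in simp)
    qed simp
  qed
qed

section \<open>Direct sums and uniform pavings\<close>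

text \<open>Through the pairing function, the sequence space becomes a countable direct sum of
  copies of itself: \<open>column k\<close> restricts to the k-th summand and \<open>embed k\<close>
  is its isometric inclusion.\<close>

definition column :: "nat \<Rightarrow> ell2 \<Rightarrow> ell2" where
  "column k x = Abs_ell2 (\<lambda>m. coord x (prod_encode (k, m)))"

definition embed :: "nat \<Rightarrow> ell2 \<Rightarrow> ell2" where
  "embed k y = Abs_ell2 (\<lambda>n. if fst (prod_decode n) = k then coord y (snd (prod_decode n)) else 0)"

lemma strict_mono_prod_encode: "strict_mono (\<lambda>m. prod_encode (k, m))"
  by (rule strict_monoI_Suc) (simp add: prod_encode_def)

lemma prod_encode_cases: obtains i j where "n = prod_encode (i, j)"
proof
  show "n = prod_encode (fst (prod_decode n), snd (prod_decode n))" by simp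
qed

lemma range_prod_encode: "n \<in> range (\<lambda>m. prod_encode (k, m)) \<longleftrightarrow> fst (prod_decode n) = k"
  by (rule prod_encode_cases[of n]) (auto simp: image_iff)

lemma coord_column: "coord (column k x) m = coord x (prod_encode (k, m))"
proof -
  have "inj (\<lambda>m. prod_encode (k, m))" using strict_mono_prod_encode by (rule strict_mono_imp_inj_on)
  then have "summable ((\<lambda>n. (cmod (coord x n))\<^sup>2) \<circ> (\<lambda>m. prod_encode (k, m)))"
    by (intro summable_reindex coord_summable) auto
  then show ?thesis by (simp add: column_def Abs_ell2_inverse o_def)
qed

lemma coord_embed:
  "coord (embed k y) n = (if fst (prod_decode n) = k then coord y (snd (prod_decode n)) else 0)"
proof -
  let ?e = "\<lambda>n. if fst (prod_decode n) = k then coord y (snd (prod_decode n)) else 0"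
  have "summable (\<lambda>m. (cmod (?e (prod_encode (k, m))))\<^sup>2)
      \<longleftrightarrow> summable (\<lambda>n. (cmod (?e n))\<^sup>2)"
    by (rule summable_mono_reindex[OF strict_mono_prod_encode, where f = "\<lambda>n. (cmod (?e n))\<^sup>2"])
      (auto simp: range_prod_encode)
  then have "summable (\<lambda>n. (cmod (?e n))\<^sup>2)" by (simp add: coord_summable)
  then show ?thesis by (simp add: embed_def Abs_ell2_inverse)
qed

lemma cinner_embed: "cinner (embed k x) (embed k y) = cinner x y"
proof -
  have "cinner (embed k x) (embed k y)
    = (\<Sum>m. coord (embed k x) (prod_encode (k, m)) * cnj (coord (embed k y) (prod_encode (k, m))))"
    unfolding cinner_def
    by (rule suminf_mono_reindex[OF strict_mono_prod_encode, symmetric,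
          where f = "\<lambda>n. coord (embed k x) n * cnj (coord (embed k y) n)"])
      (auto simp: range_prod_encode coord_embed)
  then show ?thesis by (simp add: coord_embed cinner_def)
qed

lemma inner_embed [simp]: "inner (embed k x) (embed k y) = inner x y"
  by (simp add: inner_ell2_def cinner_embed)

lemma norm_embed [simp]: "norm (embed k x) = norm x"
  by (simp add: norm_eq_sqrt_inner)

lemma embed_add: "embed k (x + y) = embed k x + embed k y"
  by (rule ell2_eqI) (simp add: coord_embed)

lemma embed_scaleR: "embed k (r *\<^sub>R x) = r *\<^sub>R embed k x"
  by (rule ell2_eqI) (simp add: coord_embed)

lemma column_embed: "column j (embed k y) = (if j = k then y else 0)"
  by (rule ell2_eqI) (simp add: coord_column coord_embed)

lemma basis_vec_embed: "basis_vec (prod_encode (k, m)) = embed k (basis_vec m)"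
proof (rule ell2_eqI)
  fix n
  obtain i j where n: "n = prod_encode (i, j)" by (rule prod_encode_cases)
  show "coord (basis_vec (prod_encode (k, m))) n = coord (embed k (basis_vec m)) n"
    by (auto simp: n coord_basis_vec coord_embed)
qed

text \<open>Finite rectangles of indices inject into the natural numbers, so their sums are
  dominated by the full series; the column lengths are then sent to infinity.\<close>

lemma sum_norm_column_le: "(\<Sum>k<K. (norm (column k x))\<^sup>2) \<le> (norm x)\<^sup>2"
proof (rule tendsto_upperbound)
  show "(\<lambda>L. \<Sum>k<K. \<Sum>m<L. (cmod (coord (column k x) m))\<^sup>2) \<longlonglongrightarrow> (\<Sum>k<K. (norm (column k x))\<^sup>2)"
    unfolding norm_sq_ell2 by (intro tendsto_sum summable_LIMSEQ coord_summable)
  have "(\<Sum>k<K. \<Sum>m<L. (cmod (coord (column k x) m))\<^sup>2) \<le> (norm x)\<^sup>2" for L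
  proof -
    have "(\<Sum>k<K. \<Sum>m<L. (cmod (coord (column k x) m))\<^sup>2)
      = (\<Sum>p\<in>{..<K} \<times> {..<L}. (cmod (coord x (prod_encode p)))\<^sup>2)"
      by (simp add: sum.cartesian_product coord_column case_prod_beta)
    also have "\<dots> = (\<Sum>n\<in>prod_encode ` ({..<K} \<times> {..<L}). (cmod (coord x n))\<^sup>2)"
      by (simp add: sum.reindex inj_prod_encode o_def)
    also have "\<dots> \<le> (norm x)\<^sup>2"
      unfolding norm_sq_ell2 by (rule sum_le_suminf[OF coord_summable]) auto
    finally show ?thesis .
  qed
  then show "\<forall>\<^sub>F L in sequentially. (\<Sum>k<K. \<Sum>m<L. (cmod (coord (column k x) m))\<^sup>2) \<le> (norm x)\<^sup>2"
    by simp
qed simp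

text \<open>The common norm bound makes the blockwise image square-summable: partial sums are
  dominated by finite squares of indices and estimated column by column.\<close>

lemma direct_sum_exists:
  assumes T: "\<And>k. norm (T k) \<le> M"
  obtains S where "norm S \<le> M" "\<And>x k m. coord (app S x) (prod_encode (k, m)) = coord (app (T k) (column k x)) m"
proof -
  have M: "0 \<le> M" using T[of 0] norm_ge_zero order_trans by blast
  define h where "h x p = coord (app (T (fst p)) (column (fst p) x)) (snd p)" for x p
  have bound: "(\<Sum>n<N. (cmod (h x (prod_decode n)))\<^sup>2) \<le> (M * norm x)\<^sup>2" for N x
  proof -
    have "(\<Sum>n<N. (cmod (h x (prod_decode n)))\<^sup>2) = (\<Sum>p\<in>prod_decode ` {..<N}. (cmod (h x p))\<^sup>2)"
      by (simp add: sum.reindex inj_prod_decode o_def)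
    also have "\<dots> \<le> (\<Sum>p\<in>{..<N} \<times> {..<N}. (cmod (h x p))\<^sup>2)"
    proof (rule sum_mono2)
      \<comment> \<open>Both components of a decoded number are at most that number, so the first
        \<open>N\<close> codes stay inside an \<open>N\<close> by \<open>N\<close> square.\<close>
      show "prod_decode ` {..<N} \<subseteq> {..<N} \<times> {..<N}"
      proof
        fix p assume "p \<in> prod_decode ` {..<N}"
        then obtain n where n: "n < N" "p = prod_decode n" by auto
        obtain i j where ij: "p = (i, j)" by (cases p)
        then have "prod_encode (i, j) = n" using n(2) by (metis prod_decode_inverse)
        then show "p \<in> {..<N} \<times> {..<N}"
          using le_prod_encode_1[of i j] le_prod_encode_2[of j i] n(1) ij by auto
      qed
    qed auto
    also have "\<dots> = (\<Sum>k<N. \<Sum>m<N. (cmod (coord (app (T k) (column k x)) m))\<^sup>2)"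
      by (simp add: sum.cartesian_product h_def case_prod_beta)
    also have "\<dots> \<le> (\<Sum>k<N. (M * norm (column k x))\<^sup>2)"
    proof (rule sum_mono)
      fix k
      have "(\<Sum>m<N. (cmod (coord (app (T k) (column k x)) m))\<^sup>2) \<le> (norm (app (T k) (column k x)))\<^sup>2"
        unfolding norm_sq_ell2 by (rule sum_le_suminf[OF coord_summable]) auto
      also have "\<dots> \<le> (M * norm (column k x))\<^sup>2"
        using order_trans[OF app_norm_le mult_right_mono[OF T]] by (intro power_mono) auto
      finally show "(\<Sum>m<N. (cmod (coord (app (T k) (column k x)) m))\<^sup>2) \<le> (M * norm (column k x))\<^sup>2" .
    qed
    also have "\<dots> \<le> (M * norm x)\<^sup>2"
      using mult_left_mono[OF sum_norm_column_le[of x N], of "M\<^sup>2"]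
      by (simp add: power_mult_distrib sum_distrib_left)
    finally show ?thesis .
  qed
  define f where "f x = Abs_ell2 (\<lambda>n. h x (prod_decode n))" for x
  have summ: "summable (\<lambda>n. (cmod (h x (prod_decode n)))\<^sup>2)" for x
    by (rule summableI_nonneg_bounded[OF _ bound]) simp
  then have f: "coord (f x) n = h x (prod_decode n)" for x n
    by (simp add: f_def Abs_ell2_inverse)
  have col: "column k (x + y) = column k x + column k y" "column k (c *\<^sub>C x) = c *\<^sub>C column k x" for k x y c
    by (rule ell2_eqI, simp add: coord_column)+
  have norm_f: "norm (f x) \<le> M * norm x" for x
  proof (rule power2_le_imp_le)
    show "(norm (f x))\<^sup>2 \<le> (M * norm x)\<^sup>2"
      unfolding norm_sq_ell2 f by (rule suminf_le_const[OF summ bound])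
  qed (use M in simp)
  obtain S where S: "\<And>x. app S x = f x"
  proof (rule bop_of_function[of f M])
    show "f (x + y) = f x + f y" for x y
      by (rule ell2_eqI)
        (simp add: f h_def col linear_add[OF bounded_linear.linear[OF bounded_linear_app]])
    show "f (c *\<^sub>C x) = c *\<^sub>C f x" for c x
      by (rule ell2_eqI) (simp add: f h_def col app_scaleC)
  qed (use norm_f in blast)+
  show thesis
  proof
    show "norm S \<le> M" by (rule norm_bop_le[OF M]) (simp add: S norm_f)
  qed (simp add: S f h_def)
qed

text \<open>The matrix of the sum is block diagonal, so self-adjointness and zero diagonal can be
  read off blockwise.\<close>

lemma direct_sum:
  assumes "\<And>k. norm (T k) \<le> M"
  obtains S where "norm S \<le> M" "\<And>k y. app S (embed k y) = embed k (app (T k) y)"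
    "(\<And>k. adj (T k) = T k) \<Longrightarrow> adj S = S" "(\<And>k. cond_exp (T k) = 0) \<Longrightarrow> cond_exp S = 0"
proof -
  obtain S where nS: "norm S \<le> M"
    and S: "\<And>x k m. coord (app S x) (prod_encode (k, m)) = coord (app (T k) (column k x)) m"
    using direct_sum_exists[of T M] assms by blast
  have "app S (embed k y) = embed k (app (T k) y)" for k y
  proof (rule ell2_eqI)
    fix n
    obtain i j where n: "n = prod_encode (i, j)" by (rule prod_encode_cases)
    show "coord (app S (embed k y)) n = coord (embed k (app (T k) y)) n"
      by (simp add: n S column_embed coord_embed linear_0[OF bounded_linear.linear[OF bounded_linear_app]])
  qed
  note emb = this
  have entry_S: "entry S (prod_encode (i, m)) (prod_encode (j, l)) = (if i = j then entry (T j) m l else 0)"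
    for i j m l
    by (simp add: entry_def basis_vec_embed emb coord_embed)
  have "adj S = S" if sa: "\<And>k. adj (T k) = T k"
  proof (rule bop_eq_entry)
    fix n n'
    obtain i m where n: "n = prod_encode (i, m)" by (rule prod_encode_cases)
    obtain j l where n': "n' = prod_encode (j, l)" by (rule prod_encode_cases)
    have "cnj (entry (T j) l m) = entry (T j) m l" using sa entry_adj by metis
    then show "entry (adj S) n n' = entry S n n'" by (auto simp: n n' entry_adj entry_S)
  qed
  moreover have "cond_exp S = 0" if "\<And>k. cond_exp (T k) = 0"
    unfolding cond_exp_eq_0_iff
  proof
    fix n
    obtain i m where n: "n = prod_encode (i, m)" by (rule prod_encode_cases)
    show "entry S n n = 0" using that by (simp add: n entry_S cond_exp_eq_0_iff)
  qed
  ultimately show thesis using that nS emb by blast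
qed

lemma below_on_embed:
  assumes "\<And>y. app S (embed k y) = embed k (app T y)" "below_on S c A"
  shows "below_on T c {m. prod_encode (k, m) \<in> A}"
  unfolding below_on_def
proof (intro allI impI)
  fix y assume y: "supported {m. prod_encode (k, m) \<in> A} y"
  have "supported A (embed k y)"
    unfolding supported_def
  proof (intro allI impI)
    fix n assume n: "n \<notin> A"
    obtain i j where "n = prod_encode (i, j)" by (rule prod_encode_cases)
    then show "coord (embed k y) n = 0" using y n by (auto simp: supported_def coord_embed)
  qed
  then show "c * (norm y)\<^sup>2 \<le> inner (app T y) y"
    using assms(2) unfolding below_on_def by (metis assms(1) inner_embed norm_embed)
qed

text \<open>The number of sets is unchanged, possibly with some of them empty; the contradiction in
  the uniform versions rests on this.\<close>

lemma paving_column: "paving r A \<Longrightarrow> paving r (\<lambda>i. {m. prod_encode (k, m) \<in> A i})"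
  unfolding paving_def disjoint_family_on_def by (auto simp: set_eq_iff)

lemma op_inverse_embed:
  assumes "op_invertible S" "op_invertible T" "\<And>y. app S (embed k y) = embed k (app T y)"
  shows "app (op_inverse S) (embed k y) = embed k (app (op_inverse T) y)"
  using app_op_inverse(2)[OF assms(1), of "embed k (app (op_inverse T) y)"]
  by (simp add: assms(3) app_op_inverse(1)[OF assms(2)])

text \<open>Subtracting the midpoint turns the order interval into a norm ball of self-adjoint
  operators, a condition that passes to direct sums.\<close>

lemma op_interval_iff_norm:
  assumes "0 \<le> a" "a \<le> b"
  shows "P \<in> op_interval a b \<longleftrightarrow> adj P = P \<and> norm (P - ((a + b) / 2) *\<^sub>R 1) \<le> (b - a) / 2"
proof (cases "adj P = P")
  case True
  define T where "T = P - ((a + b) / 2) *\<^sub>R 1"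
  have sa: "adj T = T" using True by (simp add: T_def adj_diff adj_scaleR)
  have "norm T \<le> (b - a) / 2 \<longleftrightarrow> (\<forall>x. \<bar>inner (app T x) x\<bar> \<le> (b - a) / 2 * (norm x)\<^sup>2)"
    using self_adj_norm_le[OF sa, of "(b - a) / 2"] assms
      order_trans[OF abs_inner_app_le mult_right_mono[of "norm T" "(b - a) / 2"]] by auto
  moreover have "\<bar>inner (app T x) x\<bar> \<le> (b - a) / 2 * (norm x)\<^sup>2 \<longleftrightarrow>
    a * (norm x)\<^sup>2 \<le> inner (app P x) x \<and> inner (app P x) x \<le> b * (norm x)\<^sup>2" for x
  proof -
    have "inner (app T x) x = inner (app P x) x - (a + b) / 2 * (norm x)\<^sup>2"
      by (simp add: T_def inner_diff_left power2_norm_eq_inner)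
    moreover have "\<bar>p - c\<bar> \<le> r \<longleftrightarrow> l \<le> p \<and> p \<le> u" if "c - r = l" "c + r = u" for p c r l u :: real
      using that by auto
    moreover have "(a + b) / 2 * (norm x)\<^sup>2 - (b - a) / 2 * (norm x)\<^sup>2 = a * (norm x)\<^sup>2"
      "(a + b) / 2 * (norm x)\<^sup>2 + (b - a) / 2 * (norm x)\<^sup>2 = b * (norm x)\<^sup>2"
      by (simp_all add: field_simps)
    ultimately show ?thesis by presburger
  qed
  ultimately show ?thesis using True assms(1) by (simp add: op_interval_iff T_def)
qed (use assms in \<open>simp add: op_interval_iff\<close>)

section \<open>Two-sided bounds and the passage to uniform pavings\<close>

definition small_on :: "bop \<Rightarrow> real \<Rightarrow> nat set \<Rightarrow> bool" where
  "small_on H e A \<longleftrightarrow> below_on H (- e) A \<and> below_on (- H) (- e) A"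

lemma small_on_mono: "small_on H e A \<Longrightarrow> B \<subseteq> A \<Longrightarrow> small_on H e B"
  unfolding small_on_def by (meson below_on_mono)

lemma small_on_iff_le:
  assumes "adj H = H"
  shows "small_on H e A \<longleftrightarrow> - (e *\<^sub>R diag_proj A) \<le> diag_proj A * H * diag_proj A \<and>
    diag_proj A * H * diag_proj A \<le> e *\<^sub>R diag_proj A"
  using below_on_iff[OF assms, of "- e" A] below_on_minus_iff[OF assms, of A e] by (simp add: small_on_def)

lemma norm_compression_le:
  assumes H: "adj H = H" and e: "0 \<le> e" and small: "small_on H e A"
  shows "norm (diag_proj A * H * diag_proj A) \<le> e"
proof (rule self_adj_norm_le[OF adj_compression[OF H] e])
  fix x
  let ?u = "app (diag_proj A) x"
  have "\<bar>inner (app H ?u) ?u\<bar> \<le> e * (norm ?u)\<^sup>2"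
    using small supported_diag_proj[of A x] unfolding small_on_def below_on_def
    by (fastforce simp: abs_le_iff)
  also have "\<dots> \<le> e * (norm x)\<^sup>2"
    using norm_diag_proj_le[of A x] e by (intro mult_left_mono power_mono) auto
  finally show "\<bar>inner (app (diag_proj A * H * diag_proj A) x) x\<bar> \<le> e * (norm x)\<^sup>2"
    unfolding inner_compression .
qed

lemma small_on_norm_compression: "small_on H (norm (diag_proj A * H * diag_proj A)) A"
proof -
  let ?N = "norm (diag_proj A * H * diag_proj A)"
  have "\<bar>inner (app H x) x\<bar> \<le> ?N * (norm x)\<^sup>2" if "supported A x" for x
    using abs_inner_app_le[of "diag_proj A * H * diag_proj A" x]
    unfolding inner_compression diag_proj_supported[OF that] .
  then show ?thesis unfolding small_on_def below_on_def by (auto simp: abs_le_iff) (smt (verit))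
qed

lemma small_on_weaken: "small_on H d A \<Longrightarrow> d \<le> e \<Longrightarrow> small_on H e A"
  unfolding small_on_def by (auto elim: below_on_weaken)

text \<open>One-sided pavings of \<open>H\<close> and \<open>- H\<close> have a common refinement,
  on which \<open>H\<close> is bounded from both sides.\<close>

lemma pavable_iff_small:
  "pavable \<longleftrightarrow> (\<forall>H \<epsilon>. adj H = H \<longrightarrow> cond_exp H = 0 \<longrightarrow> \<epsilon> > 0 \<longrightarrow> (\<exists>r A. paving r A \<and> (\<forall>i\<in>{1..r}. small_on H \<epsilon> (A i))))"
proof -
  have "finitely_covers (small_on H \<epsilon>)" if pav: pavable and H: "adj H = H" "cond_exp H = 0" and "\<epsilon> > 0" for H \<epsilon>
  proof -
    have "adj (- H) = - H" "cond_exp (- H) = 0"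
      using H by (simp_all add: adj_minus cond_exp_eq_0_iff)
    then have "finitely_covers (below_on H (- \<epsilon>))" "finitely_covers (below_on (- H) (- \<epsilon>))"
      using pav H \<open>\<epsilon> > 0\<close> unfolding pavable_def by blast+
    then have "finitely_covers (\<lambda>A. below_on H (- \<epsilon>) A \<and> below_on (- H) (- \<epsilon>) A)"
      by (rule finitely_covers_conj) (blast intro: below_on_mono)+
    then show ?thesis by (rule finitely_covers_mono) (simp add: small_on_def)
  qed
  then have "pavable \<longleftrightarrow> (\<forall>H \<epsilon>. adj H = H \<longrightarrow> cond_exp H = 0 \<longrightarrow> \<epsilon> > 0 \<longrightarrow> finitely_covers (small_on H \<epsilon>))"
    unfolding pavable_def by (metis finitely_covers_mono small_on_def)
  then show ?thesis using finitely_covers_iff_paving[OF small_on_mono] by simp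
qed

text \<open>If no \<open>r\<close> works for all operators, each \<open>r\<close> has a
  counterexample; paving their direct sum once defeats one of them.\<close>

lemma pavable_imp_uniform:
  assumes pavable and \<epsilon>: "\<epsilon> > 0"
  shows "\<exists>r. \<forall>H. adj H = H \<and> cond_exp H = 0 \<longrightarrow>
    (\<exists>A. paving r A \<and> (\<forall>i\<in>{1..r}. norm (diag_proj (A i) * H * diag_proj (A i)) \<le> \<epsilon> * norm H))"
proof (rule ccontr)
  assume "\<not> ?thesis"
  then obtain H where H: "\<And>r. adj (H r) = H r" "\<And>r. cond_exp (H r) = 0"
    and no: "\<And>r A. paving r A \<Longrightarrow>
      \<exists>i\<in>{1..r}. \<not> norm (diag_proj (A i) * H r * diag_proj (A i)) \<le> \<epsilon> * norm (H r)"
    by metis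
  \<comment> \<open>Normalising makes the direct sum bounded. If \<open>H r = 0\<close>, then
    \<open>T r = 0\<close>, and the rescaling identity still holds.\<close>
  define T where "T r = H r /\<^sub>R norm (H r)" for r
  have HT: "H r = norm (H r) *\<^sub>R T r" for r by (cases "H r = 0") (simp_all add: T_def)
  have "norm (T r) \<le> 1" for r by (cases "H r = 0") (simp_all add: T_def)
  then obtain S where S: "\<And>k y. app S (embed k y) = embed k (app (T k) y)"
    and "(\<And>k. adj (T k) = T k) \<Longrightarrow> adj S = S" "(\<And>k. cond_exp (T k) = 0) \<Longrightarrow> cond_exp S = 0"
    using direct_sum[of T 1] by metis
  then have "adj S = S" "cond_exp S = 0"
    using H by (simp_all add: T_def adj_scaleR cond_exp_eq_0_iff)
  \<comment> \<open>The paving of the sum fixes \<open>r\<close>; the summand with this same index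
    is the one that admits no good \<open>r\<close>-paving.\<close>
  then obtain r A where A: "paving r A" "\<And>i. i \<in> {1..r} \<Longrightarrow> small_on S \<epsilon> (A i)"
    using assms unfolding pavable_iff_small by blast
  define B where "B i = {m. prod_encode (r, m) \<in> A i}" for i
  have "paving r B" unfolding B_def by (rule paving_column[OF A(1)])
  moreover have "norm (diag_proj (B i) * H r * diag_proj (B i)) \<le> \<epsilon> * norm (H r)" if "i \<in> {1..r}" for i
  proof (rule norm_compression_le[OF H(1)])
    have "app (- S) (embed k y) = embed k (app (- T k) y)" for k y
      using embed_scaleR[of k "-1"] by (simp add: S)
    then have "below_on (T r) (- \<epsilon>) (B i)" "below_on (- T r) (- \<epsilon>) (B i)"
      using A(2)[OF that] below_on_embed[of S r "T r"] below_on_embed[of "- S" r "- T r"] S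
      unfolding small_on_def B_def by blast+
    then have b: "- \<epsilon> * (norm x)\<^sup>2 \<le> inner (app (T r) x) x" "inner (app (T r) x) x \<le> \<epsilon> * (norm x)\<^sup>2"
      if "supported (B i) x" for x using that by (auto simp: below_on_def)
    have HTx: "inner (app (H r) x) x = norm (H r) * inner (app (T r) x) x" for x
      by (subst HT) simp
    show "small_on (H r) (\<epsilon> * norm (H r)) (B i)"
      unfolding small_on_def below_on_def
    proof (intro conjI allI impI)
      fix x assume "supported (B i) x"
      from b[OF this] have
        "norm (H r) * (- \<epsilon> * (norm x)\<^sup>2) \<le> norm (H r) * inner (app (T r) x) x"
        "norm (H r) * inner (app (T r) x) x \<le> norm (H r) * (\<epsilon> * (norm x)\<^sup>2)"
        by (intro mult_left_mono; simp)+
      then show "- (\<epsilon> * norm (H r)) * (norm x)\<^sup>2 \<le> inner (app (H r) x) x"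
        "- (\<epsilon> * norm (H r)) * (norm x)\<^sup>2 \<le> inner (app (- H r) x) x"
        by (simp_all add: HTx algebra_simps)
    qed
  qed (use \<epsilon> in simp)
  ultimately show False using no[of r B] by blast
qed

text \<open>The direct sum of counterexamples stays in the same order interval, and its inverse acts
  blockwise by their inverses, so both lower bounds restrict to each summand with the same
  constants.\<close>

lemma inverse_paved_imp_uniform:
  assumes ab: "0 < a" "a \<le> b"
    and pav: "\<And>P. P \<in> op_interval a b \<Longrightarrow> finitely_covers (inverse_paved P \<epsilon>)"
  shows "\<exists>r. \<forall>P\<in>op_interval a b. \<exists>A. paving r A \<and> (\<forall>i\<in>{1..r}. inverse_paved P \<epsilon> (A i))"
proof (rule ccontr)
  assume "\<not> ?thesis"
  then obtain P where P: "\<And>r. P r \<in> op_interval a b"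
    and no: "\<And>r A. paving r A \<Longrightarrow> \<exists>i\<in>{1..r}. \<not> inverse_paved (P r) \<epsilon> (A i)"
    by metis
  define \<mu> where "\<mu> = (a + b) / 2"
  \<comment> \<open>The sum is formed after subtracting the midpoint, where membership in the
    interval is a norm bound, and the midpoint is added back in \<open>R\<close>.\<close>
  define T where "T r = P r - \<mu> *\<^sub>R 1" for r
  note iff = op_interval_iff_norm[OF less_imp_le[OF ab(1)] ab(2), folded \<mu>_def]
  have T: "adj (T r) = T r" "norm (T r) \<le> (b - a) / 2" for r
    using P[of r] by (simp_all add: iff T_def adj_diff adj_scaleR)
  then obtain S where nS: "norm S \<le> (b - a) / 2"
    and S: "\<And>k y. app S (embed k y) = embed k (app (T k) y)" and sa: "adj S = S"
    using direct_sum[of T "(b - a) / 2"] by metis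
  define R where "R = S + \<mu> *\<^sub>R 1"
  have R: "R \<in> op_interval a b"
    unfolding iff using nS sa by (simp add: R_def adj_add adj_scaleR)
  have emb: "app R (embed k y) = embed k (app (P k) y)" for k y
  proof -
    have "app R (embed k y) = embed k (app (T k) y + \<mu> *\<^sub>R y)"
      by (simp add: R_def S embed_add embed_scaleR)
    then show ?thesis by (simp add: T_def)
  qed
  obtain r A where A: "paving r A" "\<And>i. i \<in> {1..r} \<Longrightarrow> inverse_paved R \<epsilon> (A i)"
    using pav[OF R] finitely_covers_iff_paving[of "inverse_paved R \<epsilon>"] inverse_paved_mono by blast
  define B where "B i = {m. prod_encode (r, m) \<in> A i}" for i
  have "inverse_paved (P r) \<epsilon> (B i)" if i: "i \<in> {1..r}" for i
  proof -
    obtain c d where cd: "c > 0" "d > 0" "c * d > 1 - \<epsilon>" "below_on R c (A i)" "below_on (op_inverse R) d (A i)"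
      using A(2)[OF i] unfolding inverse_paved_def by blast
    have "below_on (P r) c (B i)" "below_on (op_inverse (P r)) d (B i)"
      unfolding B_def
      using below_on_embed[OF emb cd(4)]
        below_on_embed[OF op_inverse_embed[OF op_interval_invertible(1)[OF ab(1) R]
          op_interval_invertible(1)[OF ab(1) P] emb] cd(5)] by blast+
    then show ?thesis using cd unfolding inverse_paved_def by blast
  qed
  moreover have "paving r B" unfolding B_def by (rule paving_column[OF A(1)])
  ultimately show False using no by blast
qed

section \<open>Assembling the equivalences\<close>

lemma inverse_paving_iff:
  assumes "op_invertible P" "adj P = P"
  shows "(\<exists>c d. paving r A \<and> (\<forall>i\<in>{1..r}. c i > 0 \<and> d i > 0 \<and> c i * d i > 1 - \<epsilon> \<and>
      c i *\<^sub>R diag_proj (A i) \<le> diag_proj (A i) * P * diag_proj (A i) \<and>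
      d i *\<^sub>R diag_proj (A i) \<le> diag_proj (A i) * op_inverse P * diag_proj (A i)))
    \<longleftrightarrow> paving r A \<and> (\<forall>i\<in>{1..r}. inverse_paved P \<epsilon> (A i))"
  unfolding inverse_paved_def below_on_iff[OF assms(2)]
    below_on_iff[OF op_inverse_self_adj[OF assms]]
  by metis

lemma finitely_covers_inverse_paved_iff:
  "finitely_covers (inverse_paved P \<epsilon>) \<longleftrightarrow>
    (\<exists>r A. paving r A \<and> (\<forall>i\<in>{1..r}. inverse_paved P \<epsilon> (A i)))"
  by (rule finitely_covers_iff_paving) (rule inverse_paved_mono)

lemma op_interval_self_adj_invertible:
  assumes "0 < a" "P \<in> op_interval a b"
  shows "positive_op P" "op_invertible P" "adj P = P"
  using assms op_interval_invertible op_interval_iff[of a P b] by (auto simp: op_interval_def)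

theorem theorem2p9:
  fixes a b :: real
  assumes "0 < a" and "a < 1" and "1 < b"
  shows
    "(kadison_singer \<longleftrightarrow>
        (\<forall>H \<epsilon>::real. adj H = H \<and> cond_exp H = 0 \<and> \<epsilon> > 0 \<longrightarrow>
          (\<exists>r A. paving r A \<and>
            (\<forall>i\<in>{1..r}. - (\<epsilon> *\<^sub>R diag_proj (A i)) \<le> diag_proj (A i) * H * diag_proj (A i) \<and>
              diag_proj (A i) * H * diag_proj (A i) \<le> \<epsilon> *\<^sub>R diag_proj (A i)))))
     \<and> (kadison_singer \<longleftrightarrow>
        (\<forall>\<epsilon>::real. \<epsilon> > 0 \<longrightarrow> (\<exists>r. \<forall>H. adj H = H \<and> cond_exp H = 0 \<longrightarrow>
          (\<exists>A. paving r A \<and>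
            (\<forall>i\<in>{1..r}. norm (diag_proj (A i) * H * diag_proj (A i)) \<le> \<epsilon> * norm H)))))
     \<and> (kadison_singer \<longleftrightarrow>
        (\<forall>P \<epsilon>::real. positive_op P \<and> op_invertible P \<and> \<epsilon> > 0 \<longrightarrow>
          (\<exists>r A (c :: nat \<Rightarrow> real) (d :: nat \<Rightarrow> real). paving r A \<and>
            (\<forall>i\<in>{1..r}. c i > 0 \<and> d i > 0 \<and> c i * d i > 1 - \<epsilon> \<and>
              c i *\<^sub>R diag_proj (A i) \<le> diag_proj (A i) * P * diag_proj (A i) \<and>
              d i *\<^sub>R diag_proj (A i) \<le> diag_proj (A i) * op_inverse P * diag_proj (A i)))))
     \<and> (kadison_singer \<longleftrightarrow>
        (\<forall>P \<epsilon>::real. P \<in> op_interval a b \<and> \<epsilon> > 0 \<longrightarrow>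
          (\<exists>r A (c :: nat \<Rightarrow> real) (d :: nat \<Rightarrow> real). paving r A \<and>
            (\<forall>i\<in>{1..r}. c i > 0 \<and> d i > 0 \<and> c i * d i > 1 - \<epsilon> \<and>
              c i *\<^sub>R diag_proj (A i) \<le> diag_proj (A i) * P * diag_proj (A i) \<and>
              d i *\<^sub>R diag_proj (A i) \<le> diag_proj (A i) * op_inverse P * diag_proj (A i)))))
     \<and> (kadison_singer \<longleftrightarrow>
        (\<forall>\<epsilon>::real. \<epsilon> > 0 \<longrightarrow> (\<exists>r. \<forall>P\<in>op_interval a b.
          (\<exists>A (c :: nat \<Rightarrow> real) (d :: nat \<Rightarrow> real). paving r A \<and>
            (\<forall>i\<in>{1..r}. c i > 0 \<and> d i > 0 \<and> c i * d i > 1 - \<epsilon> \<and>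
              c i *\<^sub>R diag_proj (A i) \<le> diag_proj (A i) * P * diag_proj (A i) \<and>
              d i *\<^sub>R diag_proj (A i) \<le> diag_proj (A i) * op_inverse P * diag_proj (A i))))))"
proof -
  have conv: "(\<exists>A c d. paving r A \<and> (\<forall>i\<in>{1..r}. c i > 0 \<and> d i > 0 \<and> c i * d i > 1 - \<epsilon> \<and>
        c i *\<^sub>R diag_proj (A i) \<le> diag_proj (A i) * P * diag_proj (A i) \<and>
        d i *\<^sub>R diag_proj (A i) \<le> diag_proj (A i) * op_inverse P * diag_proj (A i)))
      \<longleftrightarrow> (\<exists>A. paving r A \<and> (\<forall>i\<in>{1..r}. inverse_paved P \<epsilon> (A i)))"
    if "op_invertible P" "adj P = P" for P r and \<epsilon> :: real
    using inverse_paving_iff[OF that] by simp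
  have positive: "adj P = P" if "positive_op P" for P
    using that nonneg_imp_self_adj by (simp add: positive_op_iff)
  note interval = op_interval_self_adj_invertible[OF \<open>0 < a\<close>, of _ b]
  \<comment> \<open>Conditions (iv) and (vi) each yield the hypothesis here, as (v) does, so one
    return to \<open>pavable\<close> serves all three.\<close>
  have from_interval: pavable
    if "\<And>P \<epsilon>. P \<in> op_interval a b \<Longrightarrow> \<epsilon> > 0 \<Longrightarrow> \<exists>r A. paving r A \<and> (\<forall>i\<in>{1..r}. inverse_paved P \<epsilon> (A i))"
    using inverse_paved_imp_pavable[OF assms] that unfolding finitely_covers_inverse_paved_iff by blast
  have to_paved: "\<exists>r A. paving r A \<and> (\<forall>i\<in>{1..r}. inverse_paved P \<epsilon> (A i))"
    if "pavable" "positive_op P" "op_invertible P" "\<epsilon> > 0" for P \<epsilon>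
    using pavable_imp_inverse_paved[OF that] unfolding finitely_covers_inverse_paved_iff .
  have uniform: "\<exists>r. \<forall>P\<in>op_interval a b. \<exists>A. paving r A \<and> (\<forall>i\<in>{1..r}. inverse_paved P \<epsilon> (A i))"
    if "pavable" "\<epsilon> > 0" for \<epsilon>
    using assms interval pavable_imp_inverse_paved[OF that(1) _ _ that(2)]
    by (intro inverse_paved_imp_uniform) auto
  show ?thesis (is "(_ \<longleftrightarrow> ?ii) \<and> (_ \<longleftrightarrow> ?iii) \<and> (_ \<longleftrightarrow> ?iv) \<and> (_ \<longleftrightarrow> ?v) \<and> (_ \<longleftrightarrow> ?vi)")
    unfolding kadison_singer_iff_pavable
  proof (intro conjI)
    show "pavable \<longleftrightarrow> ?ii"
      unfolding pavable_iff_small by (auto simp: small_on_iff_le)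
    show "pavable \<longleftrightarrow> ?iii"
    proof
      assume pavable
      then show ?iii using pavable_imp_uniform by blast
    next
      assume iii: ?iii
      show pavable
        unfolding pavable_iff_small
      proof (intro allI impI)
        fix H and \<epsilon> :: real assume H: "adj H = H" "cond_exp H = 0" "\<epsilon> > 0"
        \<comment> \<open>The relative bound of (iii) becomes an absolute one:
          \<open>e * norm H\<close> is at most \<epsilon>, and the added 1 covers
          \<open>H = 0\<close>.\<close>
        define e where "e = \<epsilon> / (norm H + 1)"
        have "norm H + 1 > 0" by (simp add: add_nonneg_pos)
        then have e: "e > 0" "e * norm H \<le> \<epsilon>" using H(3) by (simp_all add: e_def field_simps)
        then obtain r A where "paving r A"
          and A: "\<forall>i\<in>{1..r}. norm (diag_proj (A i) * H * diag_proj (A i)) \<le> e * norm H"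
          using iii H by meson
        moreover have "small_on H \<epsilon> (A i)" if "i \<in> {1..r}" for i
          by (rule small_on_weaken[OF small_on_norm_compression]) (use A that e(2) in force)
        ultimately show "\<exists>r A. paving r A \<and> (\<forall>i\<in>{1..r}. small_on H \<epsilon> (A i))" by blast
      qed
    qed
    show "pavable \<longleftrightarrow> ?iv"
    proof
      assume pavable
      then show ?iv using to_paved conv positive by (metis (no_types, lifting))
    next
      assume iv: ?iv
      show pavable
      proof (rule from_interval)
        fix P and \<epsilon> :: real assume P: "P \<in> op_interval a b" "\<epsilon> > 0"
        then show "\<exists>r A. paving r A \<and> (\<forall>i\<in>{1..r}. inverse_paved P \<epsilon> (A i))"
          using iv interval[OF P(1)] conv by (metis (no_types, lifting))
      qed
    qed
    show "pavable \<longleftrightarrow> ?v"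
    proof
      assume pavable
      then show ?v using to_paved interval conv by (metis (no_types, lifting))
    next
      assume v: ?v
      show pavable
      proof (rule from_interval)
        fix P and \<epsilon> :: real assume P: "P \<in> op_interval a b" "\<epsilon> > 0"
        then show "\<exists>r A. paving r A \<and> (\<forall>i\<in>{1..r}. inverse_paved P \<epsilon> (A i))"
          using v interval[OF P(1)] conv by (metis (no_types, lifting))
      qed
    qed
    show "pavable \<longleftrightarrow> ?vi"
    proof
      assume pavable
      then show ?vi using uniform interval conv by (metis (no_types, lifting))
    next
      assume vi: ?vi
      show pavable
      proof (rule from_interval)
        fix P and \<epsilon> :: real assume P: "P \<in> op_interval a b" "\<epsilon> > 0"
        then show "\<exists>r A. paving r A \<and> (\<forall>i\<in>{1..r}. inverse_paved P \<epsilon> (A i))"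
          using vi interval[OF P(1)] conv by (metis (no_types, lifting))
      qed
    qed
  qed
qed

end
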